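(* Let $(X,\mathscr{A},\mu)$ be a $\sigma$-finite measure space and let $\phi\colon X\to X$ be a nonsingular ($\mathscr{A}$-measurable) transformation of $X$ such that the composition operator $C_\phi$ in $L^2(\mu)$ is densely defined. Then the following six conditions are equivalent: (i) $C_\phi$ is quasinormal; (ii) for every $\sigma\in\mathfrak{B}(\mathbb{R}_+)$, $(\chi_\sigma\circ\mathsf{h}_\phi\circ\phi)\cdot(\chi_\sigma\circ\mathsf{h}_\phi)=\chi_\sigma\circ\mathsf{h}_\phi\circ\phi$ a.e. $[\mu]$; (iii) for every $\sigma\in\mathfrak{B}(\mathbb{R}_+)$, $\mathsf{E}(\chi_\sigma\circ\mathsf{h}_\phi)=\chi_\sigma\circ\mathsf{h}_\phi\circ\phi$ a.e. $[\mu]$; (iv) for every Borel function $f\colon\mathbb{R}_+\to\overline{\mathbb{R}}_+$, $\mathsf{E}(f\circ\mathsf{h}_\phi)=f\circ\mathsf{h}_\phi\circ\phi$ a.e. $[\mu]$; (v) for every $n\in\mathbb{Z}_+$, $\mathsf{h}_{\phi^n}=\mathsf{h}_\phi^n$ a.e. $[\mu]$; (vi) $\mathsf{E}(\mathsf{h}_\phi)=\mathsf{h}_\phi\circ\phi$ a.e. $[\mu]$, and for every $n\in\mathbb{Z}_+$, $\mathsf{E}(\mathsf{h}_{\phi^n})=\mathsf{E}(\mathsf{h}_\phi)^n$ a.e. $[\mu]$.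
   Context: Notation: $\mathbb{R}_+=[0,\infty)$, $\overline{\mathbb{R}}_+=\mathbb{R}_+\cup\{\infty\}$, $\mathbb{Z}_+=\{0,1,2,\ldots\}$; $\mathfrak{B}(\mathbb{R}_+)$ is the $\sigma$-algebra of Borel subsets of $\mathbb{R}_+$; $\chi_\sigma$ is the characteristic function of $\sigma$. All measures are positive. "a.e. $[\mu]$" means almost everywhere with respect to $\mu$. $L^2(\mu)=L^2(X,\mathscr{A},\mu)$ is the Hilbert space of square integrable complex functions on $X$ with the standard inner product. Powers with exponent $0$ equal $1$; in particular $\infty^0=1$ by convention. Nonsingular transformations and composition operators: A map $\phi\colon X\to X$ is $\mathscr{A}$-measurable if $\phi^{-1}(\varDelta)\in\mathscr{A}$ for all $\varDelta\in\mathscr{A}$. It is nonsingular if, in addition, the measure $\mu\circ\phi^{-1}\colon\varDelta\mapsto\mu(\phi^{-1}(\varDelta))$ on $\mathscr{A}$ is absolutely continuous with respect to $\mu$. For nonsingular $\phi$, the composition operator $C_\phi$ in $L^2(\mu)$ is the (possibly unbounded) linear operator with domain $\mathcal{D}(C_\phi)=\{f\in L^2(\mu): f\circ\phi\in L^2(\mu)\}$ given by $C_\phi f=f\circ\phi$ for $f\in\mathcal{D}(C_\phi)$. It is well defined and is always closed. Radon-Nikodym derivatives: For $n\in\mathbb{Z}_+$, $\phi^n$ is the $n$-fold composition of $\phi$ with itself ($\phi^0$ is the identity of $X$); each $\phi^n$ is nonsingular if $\phi$ is. For nonsingular $\psi\colon X\to X$ (in particular $\psi=\phi^n$), $\mathsf{h}_\psi\colon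 X\to\overline{\mathbb{R}}_+$ denotes the $\mathscr{A}$-measurable function, unique up to sets of $\mu$-measure zero, such that $\mu(\psi^{-1}(\varDelta))=\int_\varDelta\mathsf{h}_\psi\,d\mu$ for all $\varDelta\in\mathscr{A}$. It is known that $C_\phi$ is densely defined if and only if $\mathsf{h}_\phi<\infty$ a.e. $[\mu]$. Hence the expressions $f\circ\mathsf{h}_\phi$ and $f\circ\mathsf{h}_\phi\circ\phi$, for functions $f$ on $\mathbb{R}_+$, are defined a.e. $[\mu]$; one can simply set $f(\infty)=0$ to make them defined everywhere. Conditional expectation: When $\phi$ is nonsingular and $\mathsf{h}_\phi<\infty$ a.e. $[\mu]$, the restriction $\mu|_{\phi^{-1}(\mathscr{A})}$ of $\mu$ to the $\sigma$-algebra $\phi^{-1}(\mathscr{A})=\{\phi^{-1}(\varDelta):\varDelta\in\mathscr{A}\}$ is $\sigma$-finite. For an $\mathscr{A}$-measurable $f\colon X\to\overline{\mathbb{R}}_+$, $\mathsf{E}(f)\colon X\to\overline{\mathbb{R}}_+$ denotes the $\phi^{-1}(\mathscr{A})$-measurable function, unique up to sets of measure zero, such that $\int_{\phi^{-1}(\varDelta)}f\,d\mu=\int_{\phi^{-1}(\varDelta)}\mathsf{E}(f)\,d\mu$ for all $\varDelta\in\mathscr{A}$. Quasinormality: A densely defined linear operator $A$ in a complex Hilbert space $\mathcal{H}$ is quasinormal if $A$ is closed and $U|A|\subseteq|A|U$ (inclusion of operators, i.e. $|A|U$ extends $U|A|$), where $A=U|A|$ is the polar decomposition of $A$; here $|A|$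 is the (positive selfadjoint) square root of $A^*A$ and $U$ is the partial isometry on $\mathcal{H}$ whose kernel coincides with the kernel of $A$. *)

theory Defs
  imports "HOL-Probability.Probability"
begin

section \<open>Unbounded operators in a complex Hilbert space\<close>

text \<open>
  A Hilbert space is given by an explicit carrier, since the space \<open>L\<^sup>2(\<mu>)\<close> depends on the
  measure and hence cannot be a type.  The definitions below are meant for records that satisfy
  the complex Hilbert space axioms; the inner product is linear in its first argument.
  An operator is represented by its graph, so that \<open>S \<subseteq> T\<close> is inclusion of operators
  (\<open>T\<close> extends \<open>S\<close>) and \<open>Domain T\<close> is the domain of \<open>T\<close>.
\<close>

record 'h hilbert =
  hcarrier :: "'h set"
  hzero :: 'h
  hadd :: "'h \<Rightarrow> 'h \<Rightarrow> 'h"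
  hscale :: "complex \<Rightarrow> 'h \<Rightarrow> 'h"
  hinner :: "'h \<Rightarrow> 'h \<Rightarrow> complex"

type_synonym 'h operator = "('h \<times> 'h) set"

definition hnorm :: "'h hilbert \<Rightarrow> 'h \<Rightarrow> real" where
  "hnorm H u = sqrt (Re (hinner H u u))"

definition hdist :: "'h hilbert \<Rightarrow> 'h \<Rightarrow> 'h \<Rightarrow> real" where
  "hdist H u v = hnorm H (hadd H u (hscale H (-1) v))"

definition linear_op :: "'h hilbert \<Rightarrow> 'h operator \<Rightarrow> bool" where
  "linear_op H T \<longleftrightarrow>
     T \<subseteq> hcarrier H \<times> hcarrier H \<and> single_valued T \<and>
     (hzero H, hzero H) \<in> T \<and>
     (\<forall>(x, y)\<in>T. \<forall>(x', y')\<in>T. (hadd H x x', hadd H y y') \<in> T) \<and>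
     (\<forall>c. \<forall>(x, y)\<in>T. (hscale H c x, hscale H c y) \<in> T)"

definition densely_defined :: "'h hilbert \<Rightarrow> 'h operator \<Rightarrow> bool" where
  "densely_defined H T \<longleftrightarrow> (\<forall>x\<in>hcarrier H. \<forall>e>0. \<exists>y\<in>Domain T. hdist H x y < e)"

definition closed_op :: "'h hilbert \<Rightarrow> 'h operator \<Rightarrow> bool" where
  "closed_op H T \<longleftrightarrow>
     (\<forall>s t x y. (\<forall>n. (s n, t n) \<in> T) \<and> x \<in> hcarrier H \<and> y \<in> hcarrier H \<and>
        (\<lambda>n::nat. hdist H (s n) x) \<longlonglongrightarrow> 0 \<and> (\<lambda>n. hdist H (t n) y) \<longlonglongrightarrow> 0 \<longrightarrow> (x, y) \<in> T)"

text \<open>The product \<open>ST\<close> with its maximal domain \<open>{x \<in> Domain T. T x \<in> Domain S}\<close>.\<close>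

definition op_mult :: "'h operator \<Rightarrow> 'h operator \<Rightarrow> 'h operator"  (infixl \<open>\<bullet>\<^sub>o\<close> 70) where
  "S \<bullet>\<^sub>o T = T O S"

definition adjoint_op :: "'h hilbert \<Rightarrow> 'h operator \<Rightarrow> 'h operator" where
  "adjoint_op H T = {(u, v). u \<in> hcarrier H \<and> v \<in> hcarrier H \<and>
     (\<forall>(x, y)\<in>T. hinner H y u = hinner H x v)}"

definition op_kernel :: "'h hilbert \<Rightarrow> 'h operator \<Rightarrow> 'h set" where
  "op_kernel H T = {x. (x, hzero H) \<in> T}"

definition selfadjoint_op :: "'h hilbert \<Rightarrow> 'h operator \<Rightarrow> bool" where
  "selfadjoint_op H T \<longleftrightarrow> linear_op H T \<and> densely_defined H T \<and> adjoint_op H T = T"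

definition positive_op :: "'h hilbert \<Rightarrow> 'h operator \<Rightarrow> bool" where
  "positive_op H T \<longleftrightarrow> (\<forall>(x, y)\<in>T. hinner H y x \<in> \<real>\<^sub>\<ge>\<^sub>0)"

definition bounded_op :: "'h hilbert \<Rightarrow> 'h operator \<Rightarrow> bool" where
  "bounded_op H T \<longleftrightarrow> linear_op H T \<and> Domain T = hcarrier H \<and>
     (\<exists>C. \<forall>(x, y)\<in>T. hnorm H y \<le> C * hnorm H x)"

definition partial_isometry :: "'h hilbert \<Rightarrow> 'h operator \<Rightarrow> bool" where
  "partial_isometry H U \<longleftrightarrow> bounded_op H U \<and>
     (\<forall>(x, y)\<in>U. (\<forall>z\<in>op_kernel H U. hinner H x z = 0) \<longrightarrow> hnorm H y = hnorm H x)"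

text \<open>\<open>P = |A|\<close>, the positive selfadjoint square root of \<open>A\<^sup>*A\<close>.\<close>

definition is_modulus :: "'h hilbert \<Rightarrow> 'h operator \<Rightarrow> 'h operator \<Rightarrow> bool" where
  "is_modulus H A P \<longleftrightarrow>
     selfadjoint_op H P \<and> positive_op H P \<and> P \<bullet>\<^sub>o P = adjoint_op H A \<bullet>\<^sub>o A"

definition polar_decomposition ::
  "'h hilbert \<Rightarrow> 'h operator \<Rightarrow> 'h operator \<Rightarrow> 'h operator \<Rightarrow> bool" where
  "polar_decomposition H A U P \<longleftrightarrow>
     is_modulus H A P \<and> partial_isometry H U \<and> op_kernel H U = op_kernel H A \<and> A = U \<bullet>\<^sub>o P"

text \<open>A closed densely defined operator has exactly one polar decomposition, so the existential
  quantifier below only names its two factors.\<close>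

definition quasinormal :: "'h hilbert \<Rightarrow> 'h operator \<Rightarrow> bool" where
  "quasinormal H A \<longleftrightarrow>
     linear_op H A \<and> densely_defined H A \<and> closed_op H A \<and>
     (\<exists>U P. polar_decomposition H A U P \<and> U \<bullet>\<^sub>o P \<subseteq> P \<bullet>\<^sub>o U)"

section \<open>The Hilbert space of square integrable functions\<close>

definition sq_integrable :: "'a measure \<Rightarrow> ('a \<Rightarrow> complex) \<Rightarrow> bool" where
  "sq_integrable M f \<longleftrightarrow> f \<in> borel_measurable M \<and> integrable M (\<lambda>x. (cmod (f x))\<^sup>2)"

definition L2_class :: "'a measure \<Rightarrow> ('a \<Rightarrow> complex) \<Rightarrow> ('a \<Rightarrow> complex) set" where
  "L2_class M f = {g. sq_integrable M g \<and> (AE x in M. g x = f x)}"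

definition L2_rep :: "('a \<Rightarrow> complex) set \<Rightarrow> 'a \<Rightarrow> complex" where
  "L2_rep u = (SOME f. f \<in> u)"

definition L2 :: "'a measure \<Rightarrow> ('a \<Rightarrow> complex) set hilbert" where
  "L2 M = \<lparr> hcarrier = {L2_class M f |f. sq_integrable M f},
            hzero = L2_class M (\<lambda>_. 0),
            hadd = (\<lambda>u v. L2_class M (\<lambda>x. L2_rep u x + L2_rep v x)),
            hscale = (\<lambda>c u. L2_class M (\<lambda>x. c * L2_rep u x)),
            hinner = (\<lambda>u v. LINT x|M. L2_rep u x * cnj (L2_rep v x)) \<rparr>"

lemma L2_class_self: "sq_integrable M f \<Longrightarrow> f \<in> L2_class M f"
  by (simp add: L2_class_def)

lemma L2_class_cong:
  assumes "AE x in M. f x = g x"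
  shows "L2_class M f = L2_class M g"
  unfolding L2_class_def using assms by (auto elim!: AE_mp)

lemma L2_class_eq_iff:
  assumes "sq_integrable M f"
  shows "L2_class M f = L2_class M g \<longleftrightarrow> (AE x in M. f x = g x)"
proof
  assume "L2_class M f = L2_class M g"
  with L2_class_self[OF assms] have "f \<in> L2_class M g" by simp
  then show "AE x in M. f x = g x" by (simp add: L2_class_def)
qed (rule L2_class_cong)

lemma L2_rep_class:
  assumes "sq_integrable M f"
  shows "sq_integrable M (L2_rep (L2_class M f))" "AE x in M. L2_rep (L2_class M f) x = f x"
proof -
  have "L2_rep (L2_class M f) \<in> L2_class M f"
    unfolding L2_rep_def by (rule someI[where x = f]) (rule L2_class_self[OF assms])
  then show "sq_integrable M (L2_rep (L2_class M f))" "AE x in M. L2_rep (L2_class M f) x = f x"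
    by (simp_all add: L2_class_def)
qed

lemma sq_integrable_zero: "sq_integrable M (\<lambda>_. 0)"
  by (simp add: sq_integrable_def)

lemma sq_integrable_add:
  assumes "sq_integrable M f" "sq_integrable M g"
  shows "sq_integrable M (\<lambda>x. f x + g x)"
proof -
  have [measurable]: "f \<in> borel_measurable M" "g \<in> borel_measurable M"
    using assms by (simp_all add: sq_integrable_def)
  have le: "(cmod (a + b))\<^sup>2 \<le> 2 * (cmod a)\<^sup>2 + 2 * (cmod b)\<^sup>2" for a b :: complex
  proof -
    have "(cmod (a + b))\<^sup>2 \<le> (cmod a + cmod b)\<^sup>2"
      by (intro power_mono norm_triangle_ineq norm_ge_zero)
    also have "\<dots> \<le> 2 * (cmod a)\<^sup>2 + 2 * (cmod b)\<^sup>2"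
      using zero_le_power2[of "cmod a - cmod b"] by (simp add: power2_eq_square algebra_simps)
    finally show ?thesis .
  qed
  have "integrable M (\<lambda>x. (cmod (f x + g x))\<^sup>2)"
  proof (rule Bochner_Integration.integrable_bound)
    show "integrable M (\<lambda>x. 2 * (cmod (f x))\<^sup>2 + 2 * (cmod (g x))\<^sup>2)"
      using assms by (simp add: sq_integrable_def)
    show "AE x in M. norm ((cmod (f x + g x))\<^sup>2) \<le> norm (2 * (cmod (f x))\<^sup>2 + 2 * (cmod (g x))\<^sup>2)"
      using le by (auto intro!: AE_I2)
  qed measurable
  then show ?thesis by (simp add: sq_integrable_def)
qed

lemma sq_integrable_scale:
  "sq_integrable M f \<Longrightarrow> sq_integrable M (\<lambda>x. c * f x)"
  by (auto simp: sq_integrable_def norm_mult power_mult_distrib)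

lemma integrable_inner:
  assumes "sq_integrable M f" "sq_integrable M g"
  shows "integrable M (\<lambda>x. f x * cnj (g x))"
proof -
  have [measurable]: "f \<in> borel_measurable M" "g \<in> borel_measurable M"
    using assms by (simp_all add: sq_integrable_def)
  have [measurable]: "cnj \<in> borel_measurable borel"
    by (intro borel_measurable_continuous_onI continuous_intros)
  have le: "cmod (a * cnj b) \<le> (cmod a)\<^sup>2 + (cmod b)\<^sup>2" for a b :: complex
  proof -
    have "2 * (cmod a * cmod b) \<le> (cmod a)\<^sup>2 + (cmod b)\<^sup>2"
      using zero_le_power2[of "cmod a - cmod b"] by (simp add: power2_eq_square algebra_simps)
    moreover have "0 \<le> cmod a * cmod b" by simp
    ultimately have "cmod a * cmod b \<le> (cmod a)\<^sup>2 + (cmod b)\<^sup>2" by linarith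
    then show ?thesis by (simp add: norm_mult)
  qed
  show ?thesis
  proof (rule Bochner_Integration.integrable_bound)
    show "integrable M (\<lambda>x. (cmod (f x))\<^sup>2 + (cmod (g x))\<^sup>2)"
      using assms by (simp add: sq_integrable_def)
    show "AE x in M. norm (f x * cnj (g x)) \<le> norm ((cmod (f x))\<^sup>2 + (cmod (g x))\<^sup>2)"
      using le by (auto intro!: AE_I2)
  qed measurable
qed

lemma L2_add_class:
  assumes "sq_integrable M f" "sq_integrable M g"
  shows "hadd (L2 M) (L2_class M f) (L2_class M g) = L2_class M (\<lambda>x. f x + g x)"
  unfolding L2_def hilbert.simps
  by (rule L2_class_cong) (use L2_rep_class[OF assms(1)] L2_rep_class[OF assms(2)] in auto)

lemma L2_scale_class:
  assumes "sq_integrable M f"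
  shows "hscale (L2 M) c (L2_class M f) = L2_class M (\<lambda>x. c * f x)"
  unfolding L2_def hilbert.simps
  by (rule L2_class_cong) (use L2_rep_class[OF assms] in auto)

lemma L2_inner_class:
  assumes "sq_integrable M f" "sq_integrable M g"
  shows "hinner (L2 M) (L2_class M f) (L2_class M g) = (LINT x|M. f x * cnj (g x))"
proof -
  have [measurable]: "cnj \<in> borel_measurable borel"
    by (intro borel_measurable_continuous_onI continuous_intros)
  note f = L2_rep_class[OF assms(1)] and g = L2_rep_class[OF assms(2)]
  have [measurable]: "f \<in> borel_measurable M" "g \<in> borel_measurable M"
    "L2_rep (L2_class M f) \<in> borel_measurable M" "L2_rep (L2_class M g) \<in> borel_measurable M"
    using assms f g by (simp_all add: sq_integrable_def)
  show ?thesis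
    unfolding L2_def hilbert.simps
  proof (rule integral_cong_AE)
    show "AE x in M. L2_rep (L2_class M f) x * cnj (L2_rep (L2_class M g) x) = f x * cnj (g x)"
      using f(2) g(2) by eventually_elim simp
  qed measurable
qed

section \<open>Composition operators\<close>

definition nonsingular :: "'a measure \<Rightarrow> ('a \<Rightarrow> 'a) \<Rightarrow> bool" where
  "nonsingular M \<phi> \<longleftrightarrow> \<phi> \<in> measurable M M \<and> absolutely_continuous M (distr M M \<phi>)"

definition comp_op :: "'a measure \<Rightarrow> ('a \<Rightarrow> 'a) \<Rightarrow> ('a \<Rightarrow> complex) set operator" where
  "comp_op M \<phi> = {(L2_class M f, L2_class M (f \<circ> \<phi>)) |f.
     sq_integrable M f \<and> sq_integrable M (f \<circ> \<phi>)}"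

definition RN_h :: "'a measure \<Rightarrow> ('a \<Rightarrow> 'a) \<Rightarrow> 'a \<Rightarrow> ennreal" where
  "RN_h M \<psi> = RN_deriv M (distr M M \<psi>)"

text \<open>Conditional expectation with respect to \<open>\<phi>\<^sup>-\<^sup>1(\<A>)\<close>.\<close>

definition cond_E :: "'a measure \<Rightarrow> ('a \<Rightarrow> 'a) \<Rightarrow> ('a \<Rightarrow> ennreal) \<Rightarrow> 'a \<Rightarrow> ennreal" where
  "cond_E M \<phi> f = nn_cond_exp M (vimage_algebra (space M) \<phi> M) f"

text \<open>A function on \<open>[0,\<infinity>)\<close> (given as a function on the reals) extended to \<open>[0,\<infinity>]\<close> by the
  value \<open>0\<close> at \<open>\<infinity>\<close>, so that it can be composed with Radon-Nikodym derivatives.\<close>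

definition ext0 :: "(real \<Rightarrow> ennreal) \<Rightarrow> ennreal \<Rightarrow> ennreal" where
  "ext0 f y = (if y = \<infinity> then 0 else f (enn2real y))"

abbreviation Borel_Rplus :: "real measure" where
  "Borel_Rplus \<equiv> restrict_space borel {0..}"

abbreviation char_fn :: "real set \<Rightarrow> ennreal \<Rightarrow> ennreal" where
  "char_fn \<sigma> \<equiv> ext0 (indicator \<sigma>)"

lemma (in sigma_finite_measure) RN_h_emeasure:
  assumes "nonsingular M \<psi>" "A \<in> sets M"
  shows "emeasure M (\<psi> -` A \<inter> space M) = (\<integral>\<^sup>+x\<in>A. RN_h M \<psi> x \<partial>M)"
proof -
  have "density M (RN_h M \<psi>) = distr M M \<psi>"
    using assms density_RN_deriv[of "distr M M \<psi>"] by (simp add: nonsingular_def RN_h_def)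
  then have "emeasure (distr M M \<psi>) A = emeasure (density M (RN_h M \<psi>)) A" by simp
  with assms show ?thesis
    by (simp add: emeasure_distr nonsingular_def emeasure_density RN_h_def)
qed

lemma nonsingular_AE:
  assumes "nonsingular M \<phi>" "AE x in M. P x"
  shows "AE x in M. P (\<phi> x)"
proof -
  obtain N where N: "N \<in> null_sets M" "{x \<in> space M. \<not> P x} \<subseteq> N"
    using assms(2) by (auto simp: eventually_ae_filter)
  have "N \<in> null_sets (distr M M \<phi>)"
    using N assms by (auto simp: nonsingular_def absolutely_continuous_def)
  then have "\<phi> -` N \<inter> space M \<in> null_sets M"
    using assms by (simp add: nonsingular_def null_sets_distr_iff)
  moreover have "{x \<in> space M. \<not> P (\<phi> x)} \<subseteq> \<phi> -` N \<inter> space M"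
    using N(2) assms(1) by (auto simp: nonsingular_def dest: measurable_space)
  ultimately show ?thesis by (rule AE_I')
qed

lemma linear_op_comp_op:
  assumes "nonsingular M \<phi>"
  shows "linear_op (L2 M) (comp_op M \<phi>)"
  unfolding linear_op_def
proof (intro conjI allI)
  show "comp_op M \<phi> \<subseteq> hcarrier (L2 M) \<times> hcarrier (L2 M)"
    by (auto simp: comp_op_def L2_def)
  show "single_valued (comp_op M \<phi>)"
  proof (rule single_valuedI)
    fix u v w assume "(u, v) \<in> comp_op M \<phi>" "(u, w) \<in> comp_op M \<phi>"
    then obtain f g where fg: "u = L2_class M f" "v = L2_class M (f \<circ> \<phi>)" "sq_integrable M f"
        "u = L2_class M g" "w = L2_class M (g \<circ> \<phi>)"
      by (auto simp: comp_op_def)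
    then have "AE x in M. f x = g x" using L2_class_eq_iff[of M f g] by simp
    from nonsingular_AE[OF assms this] show "v = w"
      unfolding fg(2,5) by (intro L2_class_cong) simp
  qed
  have "(\<lambda>_. 0) \<circ> \<phi> = (\<lambda>_. 0 :: complex)" by auto
  then show "(hzero (L2 M), hzero (L2 M)) \<in> comp_op M \<phi>"
    using sq_integrable_zero[of M] by (force simp: comp_op_def L2_def)
  have "(hadd (L2 M) (L2_class M f) (L2_class M g),
      hadd (L2 M) (L2_class M (f \<circ> \<phi>)) (L2_class M (g \<circ> \<phi>))) \<in> comp_op M \<phi>"
    if "sq_integrable M f" "sq_integrable M (f \<circ> \<phi>)" "sq_integrable M g" "sq_integrable M (g \<circ> \<phi>)"
    for f g
    using that sq_integrable_add[OF that(1,3)] sq_integrable_add[OF that(2,4)]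
    unfolding comp_op_def
    by (auto simp: L2_add_class comp_def intro!: exI[of _ "\<lambda>x. f x + g x"])
  then show "\<forall>(x, y)\<in>comp_op M \<phi>. \<forall>(x', y')\<in>comp_op M \<phi>.
      (hadd (L2 M) x x', hadd (L2 M) y y') \<in> comp_op M \<phi>"
    by (fastforce simp: comp_op_def)
  fix c
  have "(hscale (L2 M) c (L2_class M f), hscale (L2 M) c (L2_class M (f \<circ> \<phi>))) \<in> comp_op M \<phi>"
    if "sq_integrable M f" "sq_integrable M (f \<circ> \<phi>)" for f
    using that sq_integrable_scale[OF that(1), of c] sq_integrable_scale[OF that(2), of c]
    unfolding comp_op_def
    by (auto simp: L2_scale_class comp_def intro!: exI[of _ "\<lambda>x. c * f x"])
  then show "\<forall>(x, y)\<in>comp_op M \<phi>. (hscale (L2 M) c x, hscale (L2 M) c y) \<in> comp_op M \<phi>"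
    by (fastforce simp: comp_op_def)
qed

end

theory Submission
  imports Defs
begin

text \<open>
  Write \<open>h\<close> for the Radon-Nikodym derivative of \<open>\<phi>\<close>.  Each of the six conditions is equivalent to
  \<open>h \<circ> \<phi> = h\<close> a.e.

  The operator \<open>C\<^sup>*C\<close> is multiplication by \<open>h\<close>, the modulus is multiplication by \<open>\<surd>h\<close>, and the phase is
  \<open>U f = (f \<circ> \<phi>) / \<surd>(h \<circ> \<phi>)\<close>; with \<open>h \<circ> \<phi> = h\<close> these commute as required.  Conversely a quasinormal
  \<open>C\<close> satisfies \<open>C(C\<^sup>*C) \<subseteq> (C\<^sup>*C)C\<close>, that is \<open>(h \<circ> \<phi>) \<cdot> (f \<circ> \<phi>) = h \<cdot> (f \<circ> \<phi>)\<close>, and one may take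
  \<open>f > 0\<close>.

  Conditions (ii), (iii) and (iv) imply invariance of \<open>h\<close> by testing \<open>\<sigma>\<close> and its complement on
  intervals with rational end points.  For (v) and (vi) only the first two moments matter: they give
  \<open>E(h) = h \<circ> \<phi>\<close> and \<open>E(h\<^sup>2) = (h \<circ> \<phi>)\<^sup>2\<close>, so that the conditional variance of \<open>h\<close> is zero.
\<close>

section \<open>Square integrable functions and their classes\<close>

lemma sq_integrable_measurable: "sq_integrable M f \<Longrightarrow> f \<in> borel_measurable M"
  by (simp add: sq_integrable_def)

lemma cnj_measurable [measurable]: "cnj \<in> borel_measurable borel"
  by (intro borel_measurable_continuous_onI continuous_intros)

lemma sq_integrable_bound:
  assumes "sq_integrable M g" "f \<in> borel_measurable M" "AE x in M. cmod (f x) \<le> cmod (g x)"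
  shows "sq_integrable M f"
proof -
  note [measurable] = assms(2)
  have "integrable M (\<lambda>x. (cmod (f x))\<^sup>2)"
  proof (rule Bochner_Integration.integrable_bound)
    show "integrable M (\<lambda>x. (cmod (g x))\<^sup>2)" using assms(1) by (simp add: sq_integrable_def)
    show "AE x in M. norm ((cmod (f x))\<^sup>2) \<le> norm ((cmod (g x))\<^sup>2)"
      using assms(3) by eventually_elim (simp add: power_mono)
  qed measurable
  with assms show ?thesis by (simp add: sq_integrable_def)
qed

lemma sq_integrable_cong_AE:
  assumes "f \<in> borel_measurable M" "g \<in> borel_measurable M" "AE x in M. f x = g x"
  shows "sq_integrable M f \<longleftrightarrow> sq_integrable M g"
proof -
  have "AE x in M. cmod (f x) \<le> cmod (g x)" "AE x in M. cmod (g x) \<le> cmod (f x)"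
    using assms(3) by auto
  then show ?thesis using assms sq_integrable_bound by metis
qed

lemma hcarrier_L2: "hcarrier (L2 M) = {L2_class M f |f. sq_integrable M f}"
  by (simp add: L2_def)

lemma hzero_L2: "hzero (L2 M) = L2_class M (\<lambda>_. 0)"
  by (simp add: L2_def)

lemma L2_class_eq_zero_iff:
  "sq_integrable M f \<Longrightarrow> L2_class M f = hzero (L2 M) \<longleftrightarrow> (AE x in M. f x = 0)"
  by (simp add: hzero_L2 L2_class_eq_iff)

lemma L2_inner_self:
  assumes "sq_integrable M f"
  shows "hinner (L2 M) (L2_class M f) (L2_class M f) = complex_of_real (LINT x|M. (cmod (f x))\<^sup>2)"
  unfolding L2_inner_class[OF assms assms] complex_norm_square[symmetric] by (rule integral_complex_of_real)

lemma hnorm_L2_class: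
  "sq_integrable M f \<Longrightarrow> hnorm (L2 M) (L2_class M f) = sqrt (LINT x|M. (cmod (f x))\<^sup>2)"
  by (simp add: hnorm_def L2_inner_self)

lemma sq_integrable_diff:
  assumes "sq_integrable M f" "sq_integrable M g"
  shows "sq_integrable M (\<lambda>x. f x - g x)"
  using sq_integrable_add[OF assms(1) sq_integrable_scale[OF assms(2), of "-1"]] by simp

lemma hdist_L2_class:
  assumes "sq_integrable M f" "sq_integrable M g"
  shows "hdist (L2 M) (L2_class M f) (L2_class M g) = sqrt (LINT x|M. (cmod (f x - g x))\<^sup>2)"
proof -
  have "sq_integrable M (\<lambda>x. - 1 * g x)" using assms(2) by (rule sq_integrable_scale)
  with assms show ?thesis
    using hnorm_L2_class[OF sq_integrable_diff[OF assms]]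
    by (simp add: hdist_def L2_scale_class L2_add_class)
qed

section \<open>Weighted composition operators in \<open>L\<^sup>2\<close>\<close>

text \<open>One family for all operators that occur: weight 1 gives the composition operator,
  \<open>\<psi>\<close> the identity gives multiplications, and a suitable weight gives the phase.
  Independence of the representative is thus settled once, in \<open>wcomp_op_iff\<close>.\<close>

definition wcomp_op :: "'a measure \<Rightarrow> ('a \<Rightarrow> real) \<Rightarrow> ('a \<Rightarrow> 'a) \<Rightarrow> ('a \<Rightarrow> complex) set operator" where
  "wcomp_op M w \<psi> = {(L2_class M f, L2_class M (\<lambda>x. complex_of_real (w x) * f (\<psi> x))) |f.
     sq_integrable M f \<and> sq_integrable M (\<lambda>x. complex_of_real (w x) * f (\<psi> x))}"

abbreviation mult_op :: "'a measure \<Rightarrow> ('a \<Rightarrow> real) \<Rightarrow> ('a \<Rightarrow> complex) set operator" where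
  "mult_op M w \<equiv> wcomp_op M w (\<lambda>x. x)"

lemma comp_op_eq_wcomp_op: "comp_op M \<phi> = wcomp_op M (\<lambda>_. 1) \<phi>"
  by (simp add: comp_op_def wcomp_op_def comp_def)

lemma wcomp_op_carrier: "(u, v) \<in> wcomp_op M w \<psi> \<Longrightarrow> u \<in> hcarrier (L2 M) \<and> v \<in> hcarrier (L2 M)"
  by (auto simp: wcomp_op_def hcarrier_L2)

lemma nonsingular_ident: "nonsingular M (\<lambda>x. x)"
  by (simp add: nonsingular_def absolutely_continuous_def)

text \<open>The graph asks for some representative. Nonsingularity carries a.e. equality of
  representatives through \<open>\<psi>\<close>, so any representative decides membership.\<close>

lemma wcomp_op_iff:
  assumes "nonsingular M \<psi>" and [measurable]: "w \<in> borel_measurable M" and f: "sq_integrable M f"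
  shows "(L2_class M f, v) \<in> wcomp_op M w \<psi> \<longleftrightarrow>
    sq_integrable M (\<lambda>x. complex_of_real (w x) * f (\<psi> x)) \<and>
    v = L2_class M (\<lambda>x. complex_of_real (w x) * f (\<psi> x))"
proof
  have [measurable]: "\<psi> \<in> measurable M M" "f \<in> borel_measurable M"
    using assms by (simp_all add: nonsingular_def sq_integrable_def)
  assume "(L2_class M f, v) \<in> wcomp_op M w \<psi>"
  then obtain g where g: "L2_class M f = L2_class M g" "sq_integrable M g"
    "sq_integrable M (\<lambda>x. complex_of_real (w x) * g (\<psi> x))"
    "v = L2_class M (\<lambda>x. complex_of_real (w x) * g (\<psi> x))"
    unfolding wcomp_op_def by blast
  have [measurable]: "g \<in> borel_measurable M" using g by (simp add: sq_integrable_def)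
  have "AE x in M. f x = g x" using g(1) L2_class_eq_iff[OF f] by simp
  from nonsingular_AE[OF assms(1) this]
  have eq: "AE x in M. complex_of_real (w x) * f (\<psi> x) = complex_of_real (w x) * g (\<psi> x)"
    by eventually_elim simp
  have "sq_integrable M (\<lambda>x. complex_of_real (w x) * f (\<psi> x)) \<longleftrightarrow>
      sq_integrable M (\<lambda>x. complex_of_real (w x) * g (\<psi> x))"
    by (rule sq_integrable_cong_AE[OF _ _ eq]) measurable
  with g show "sq_integrable M (\<lambda>x. complex_of_real (w x) * f (\<psi> x)) \<and>
      v = L2_class M (\<lambda>x. complex_of_real (w x) * f (\<psi> x))"
    using L2_class_cong[OF eq] by simp
qed (use f in \<open>auto simp: wcomp_op_def\<close>)

lemma linear_op_wcomp_op:
  assumes "nonsingular M \<psi>" and [measurable]: "w \<in> borel_measurable M"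
  shows "linear_op (L2 M) (wcomp_op M w \<psi>)"
  unfolding linear_op_def
proof (intro conjI allI)
  note iff = wcomp_op_iff[OF assms]
  let ?T = "\<lambda>f x. complex_of_real (w x) * f (\<psi> x)"
  show "wcomp_op M w \<psi> \<subseteq> hcarrier (L2 M) \<times> hcarrier (L2 M)"
    using wcomp_op_carrier by fast
  show "single_valued (wcomp_op M w \<psi>)"
  proof (rule single_valuedI)
    fix u v v' assume "(u, v) \<in> wcomp_op M w \<psi>" "(u, v') \<in> wcomp_op M w \<psi>"
    moreover from this obtain f where "u = L2_class M f" "sq_integrable M f"
      by (auto simp: wcomp_op_def)
    ultimately show "v = v'" by (simp add: iff)
  qed
  show "(hzero (L2 M), hzero (L2 M)) \<in> wcomp_op M w \<psi>"
    using iff[OF sq_integrable_zero] by (simp add: hzero_L2 sq_integrable_zero)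
  have "(hadd (L2 M) (L2_class M f) (L2_class M g), hadd (L2 M) (L2_class M (?T f)) (L2_class M (?T g)))
      \<in> wcomp_op M w \<psi>"
    if "sq_integrable M f" "sq_integrable M (?T f)" "sq_integrable M g" "sq_integrable M (?T g)" for f g
    using that sq_integrable_add[OF that(1,3)] sq_integrable_add[OF that(2,4)]
    by (simp add: L2_add_class iff distrib_left)
  then show "\<forall>(x, y)\<in>wcomp_op M w \<psi>. \<forall>(x', y')\<in>wcomp_op M w \<psi>.
      (hadd (L2 M) x x', hadd (L2 M) y y') \<in> wcomp_op M w \<psi>"
    unfolding wcomp_op_def by fast
  fix c
  have "(hscale (L2 M) c (L2_class M f), hscale (L2 M) c (L2_class M (?T f))) \<in> wcomp_op M w \<psi>"
    if "sq_integrable M f" "sq_integrable M (?T f)" for f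
    using that sq_integrable_scale[OF that(1), of c] sq_integrable_scale[OF that(2), of c]
    by (simp add: L2_scale_class iff mult.left_commute)
  then show "\<forall>(x, y)\<in>wcomp_op M w \<psi>. (hscale (L2 M) c x, hscale (L2 M) c y) \<in> wcomp_op M w \<psi>"
    unfolding wcomp_op_def by fast
qed

text \<open>Core of both adjoint computations. The difference \<open>d\<close> of the two sides is
  cut off to the set where \<open>\<bar>w x\<bar> \<le> real n\<close>, which makes it an admissible
  \<open>k\<close>; the identity then gives it norm zero, and these sets exhaust the space.\<close>

lemma AE_eq_mult_of_inner_eq:
  assumes [measurable]: "w \<in> borel_measurable M" and f: "sq_integrable M f" and g: "sq_integrable M g"
    and eq: "\<And>k. sq_integrable M k \<Longrightarrow> sq_integrable M (\<lambda>x. complex_of_real (w x) * k x) \<Longrightarrow>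
      (LINT x|M. complex_of_real (w x) * k x * cnj (f x)) = (LINT x|M. k x * cnj (g x))"
  shows "AE x in M. complex_of_real (w x) * f x = g x"
proof -
  have [measurable]: "f \<in> borel_measurable M" "g \<in> borel_measurable M"
    using f g by (simp_all add: sq_integrable_def)
  define d where "d x = complex_of_real (w x) * f x - g x" for x
  have [measurable]: "d \<in> borel_measurable M" unfolding d_def by measurable
  have "AE x in M. \<bar>w x\<bar> \<le> real n \<longrightarrow> d x = 0" for n
  proof -
    define k where "k x = (if \<bar>w x\<bar> \<le> real n then d x else 0)" for x
    have [measurable]: "k \<in> borel_measurable M" unfolding k_def by measurable
    have "sq_integrable M (\<lambda>x. if \<bar>w x\<bar> \<le> real n then complex_of_real (w x) * f x else 0)"
      by (rule sq_integrable_bound[OF sq_integrable_scale[OF f, of "of_nat n"]])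
        (auto simp: norm_mult mult_right_mono intro!: AE_I2)
    moreover have "sq_integrable M (\<lambda>x. if \<bar>w x\<bar> \<le> real n then g x else 0)"
      by (rule sq_integrable_bound[OF g]) auto
    ultimately have "sq_integrable M (\<lambda>x. (if \<bar>w x\<bar> \<le> real n then complex_of_real (w x) * f x else 0) -
        (if \<bar>w x\<bar> \<le> real n then g x else 0))"
      by (rule sq_integrable_diff)
    also have "(\<lambda>x. (if \<bar>w x\<bar> \<le> real n then complex_of_real (w x) * f x else 0) -
        (if \<bar>w x\<bar> \<le> real n then g x else 0)) = k"
      by (auto simp: k_def d_def)
    finally have k: "sq_integrable M k" .
    have wk: "sq_integrable M (\<lambda>x. complex_of_real (w x) * k x)"
      by (rule sq_integrable_bound[OF sq_integrable_scale[OF k, of "of_nat n"]])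
        (auto simp: norm_mult k_def mult_right_mono intro!: AE_I2)
    have "complex_of_real (LINT x|M. (cmod (k x))\<^sup>2) = (LINT x|M. k x * cnj (k x))"
      using L2_inner_self[OF k] L2_inner_class[OF k k] by simp
    \<comment> \<open>\<open>k\<close> and \<open>d\<close> agree on the cut-off set and
      \<open>w\<close> is real, so \<open>cnj (k x)\<close> may be replaced by
      \<open>cnj (d x)\<close> and expanded.\<close>
    also have "\<dots> = (LINT x|M. complex_of_real (w x) * k x * cnj (f x) - k x * cnj (g x))"
      by (intro Bochner_Integration.integral_cong) (auto simp: k_def d_def algebra_simps)
    also have "\<dots> = 0"
      using integrable_inner[OF wk f] integrable_inner[OF k g] eq[OF k wk]
      by (subst Bochner_Integration.integral_diff) auto
    finally have "(LINT x|M. (cmod (k x))\<^sup>2) = 0" by simp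
    then have "AE x in M. (cmod (k x))\<^sup>2 = 0"
      using k by (subst (asm) integral_nonneg_eq_0_iff_AE) (auto simp: sq_integrable_def)
    then show ?thesis by eventually_elim (auto simp: k_def)
  qed
  then have "AE x in M. \<forall>n. \<bar>w x\<bar> \<le> real n \<longrightarrow> d x = 0" by (subst AE_all_countable) blast
  then show ?thesis
  proof eventually_elim
    case (elim x)
    obtain n where "\<bar>w x\<bar> \<le> real n" using real_arch_simple by blast
    with elim have "d x = 0" by blast
    then show ?case by (simp add: d_def)
  qed
qed

text \<open>A pair of the adjoint graph satisfies \<open>w x * f x = g x\<close> a.e., so the
  product is square integrable and \<open>f\<close> lies in the maximal domain. The other inclusion
  is symmetry, \<open>w\<close> being real.\<close>

lemma adjoint_op_mult_op:
  assumes [measurable]: "w \<in> borel_measurable M"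
  shows "adjoint_op (L2 M) (mult_op M w) = mult_op M w"
proof (intro equalityI subrelI)
  note iff = wcomp_op_iff[OF nonsingular_ident assms]
  fix u v assume "(u, v) \<in> adjoint_op (L2 M) (mult_op M w)"
  then obtain f g where f: "u = L2_class M f" "sq_integrable M f" and g: "v = L2_class M g" "sq_integrable M g"
    and eq: "\<And>x y. (x, y) \<in> mult_op M w \<Longrightarrow> hinner (L2 M) y u = hinner (L2 M) x v"
    unfolding adjoint_op_def hcarrier_L2 by blast
  note [measurable] = f(2)[THEN sq_integrable_measurable] g(2)[THEN sq_integrable_measurable]
  have ae: "AE x in M. complex_of_real (w x) * f x = g x"
  proof (rule AE_eq_mult_of_inner_eq)
    fix k assume k: "sq_integrable M k" "sq_integrable M (\<lambda>x. complex_of_real (w x) * k x)"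
    then have "(L2_class M k, L2_class M (\<lambda>x. complex_of_real (w x) * k x)) \<in> mult_op M w"
      by (simp add: iff)
    from eq[OF this] show "(LINT x|M. complex_of_real (w x) * k x * cnj (f x)) = (LINT x|M. k x * cnj (g x))"
      using k f g by (simp add: L2_inner_class)
  qed (use f g in auto)
  have "sq_integrable M (\<lambda>x. complex_of_real (w x) * f x) \<longleftrightarrow> sq_integrable M g"
    by (rule sq_integrable_cong_AE[OF _ _ ae]) measurable
  then show "(u, v) \<in> mult_op M w"
    using f g L2_class_cong[OF ae] by (simp add: iff)
next
  fix u v assume uv: "(u, v) \<in> mult_op M w"
  then obtain f where f: "u = L2_class M f" "sq_integrable M f"
    "v = L2_class M (\<lambda>x. complex_of_real (w x) * f x)" "sq_integrable M (\<lambda>x. complex_of_real (w x) * f x)"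
    by (auto simp: wcomp_op_def)
  have "hinner (L2 M) y u = hinner (L2 M) x v" if "(x, y) \<in> mult_op M w" for x y
  proof -
    obtain k where k: "x = L2_class M k" "sq_integrable M k"
      "y = L2_class M (\<lambda>x. complex_of_real (w x) * k x)" "sq_integrable M (\<lambda>x. complex_of_real (w x) * k x)"
      using \<open>(x, y) \<in> mult_op M w\<close> by (auto simp: wcomp_op_def)
    then show ?thesis using f by (simp add: L2_inner_class mult_ac)
  qed
  then show "(u, v) \<in> adjoint_op (L2 M) (mult_op M w)"
    using wcomp_op_carrier[OF uv] by (auto simp: adjoint_op_def)
qed

lemma positive_op_mult_op:
  assumes "\<And>x. 0 \<le> w x"
  shows "positive_op (L2 M) (mult_op M w)"
proof -
  have "hinner (L2 M) (L2_class M (\<lambda>x. complex_of_real (w x) * f x)) (L2_class M f) \<in> \<real>\<^sub>\<ge>\<^sub>0"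
    if "sq_integrable M f" "sq_integrable M (\<lambda>x. complex_of_real (w x) * f x)" for f
  proof -
    have "hinner (L2 M) (L2_class M (\<lambda>x. complex_of_real (w x) * f x)) (L2_class M f) =
        (LINT x|M. complex_of_real (w x * (cmod (f x))\<^sup>2))"
      using that by (simp add: L2_inner_class mult.assoc complex_norm_square[symmetric])
    also have "\<dots> = complex_of_real (LINT x|M. w x * (cmod (f x))\<^sup>2)"
      by (rule integral_complex_of_real)
    also have "\<dots> \<in> \<real>\<^sub>\<ge>\<^sub>0"
      using assms by (simp add: integral_nonneg_AE)
    finally show ?thesis .
  qed
  then show ?thesis by (auto simp: positive_op_def wcomp_op_def)
qed

section \<open>Operator products and commutation\<close>

lemma op_mult_mono: "S \<subseteq> S' \<Longrightarrow> T \<subseteq> T' \<Longrightarrow> S \<bullet>\<^sub>o T \<subseteq> S' \<bullet>\<^sub>o T'"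
  by (auto simp: op_mult_def)

lemma op_mult_assoc: "R \<bullet>\<^sub>o S \<bullet>\<^sub>o T = R \<bullet>\<^sub>o (S \<bullet>\<^sub>o T)"
  by (simp add: op_mult_def O_assoc)

text \<open>Avoids the uniqueness of the positive square root: a quasinormal \<open>A = UP\<close> satisfies
  \<open>A(A\<^sup>*A) = UPPP \<subseteq> PUPP \<subseteq> PPUP = (A\<^sup>*A)A\<close>.\<close>

lemma quasinormal_commutes:
  assumes "quasinormal K A"
  shows "A \<bullet>\<^sub>o (adjoint_op K A \<bullet>\<^sub>o A) \<subseteq> adjoint_op K A \<bullet>\<^sub>o A \<bullet>\<^sub>o A"
proof -
  obtain U P where PP: "P \<bullet>\<^sub>o P = adjoint_op K A \<bullet>\<^sub>o A" and A: "A = U \<bullet>\<^sub>o P" and UP: "U \<bullet>\<^sub>o P \<subseteq> P \<bullet>\<^sub>o U"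
    using assms by (auto simp: quasinormal_def polar_decomposition_def is_modulus_def)
  have "A \<bullet>\<^sub>o (P \<bullet>\<^sub>o P) = U \<bullet>\<^sub>o P \<bullet>\<^sub>o (P \<bullet>\<^sub>o P)" by (simp add: A)
  also have "\<dots> \<subseteq> P \<bullet>\<^sub>o U \<bullet>\<^sub>o (P \<bullet>\<^sub>o P)" by (intro op_mult_mono UP order_refl)
  also have "\<dots> = P \<bullet>\<^sub>o (U \<bullet>\<^sub>o P) \<bullet>\<^sub>o P" by (simp add: op_mult_assoc)
  also have "\<dots> \<subseteq> P \<bullet>\<^sub>o (P \<bullet>\<^sub>o U) \<bullet>\<^sub>o P" by (intro op_mult_mono UP order_refl)
  also have "\<dots> = P \<bullet>\<^sub>o P \<bullet>\<^sub>o A" by (simp add: A op_mult_assoc)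
  finally show ?thesis by (simp only: PP)
qed

section \<open>Invariance of the Radon-Nikodym derivative\<close>

locale nonsingular_map = sigma_finite_measure M for M :: "'a measure" +
  fixes \<phi> :: "'a \<Rightarrow> 'a"
  assumes nonsingular: "nonsingular M \<phi>"
begin

lemma phi_measurable [measurable]: "\<phi> \<in> measurable M M"
  using nonsingular by (simp add: nonsingular_def)

abbreviation h :: "'a \<Rightarrow> ennreal" where
  "h \<equiv> RN_h M \<phi>"

lemma RN_h_measurable [measurable]: "RN_h M \<psi> \<in> borel_measurable M"
  by (simp add: RN_h_def)

lemma AE_comp: "AE x in M. P x \<Longrightarrow> AE x in M. P (\<phi> x)"
  using nonsingular by (rule nonsingular_AE)

lemma nn_integral_comp_RN_h:
  assumes "nonsingular M \<psi>" and [measurable]: "f \<in> borel_measurable M"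
  shows "(\<integral>\<^sup>+x. f (\<psi> x) \<partial>M) = (\<integral>\<^sup>+x. RN_h M \<psi> x * f x \<partial>M)"
proof -
  have [measurable]: "\<psi> \<in> measurable M M" using assms by (simp add: nonsingular_def)
  have d: "density M (RN_h M \<psi>) = distr M M \<psi>"
    using assms density_RN_deriv[of "distr M M \<psi>"] by (simp add: nonsingular_def RN_h_def)
  have "(\<integral>\<^sup>+x. f (\<psi> x) \<partial>M) = integral\<^sup>N (distr M M \<psi>) f"
    by (simp add: nn_integral_distr)
  also have "\<dots> = (\<integral>\<^sup>+x. RN_h M \<psi> x * f x \<partial>M)"
    unfolding d[symmetric] by (simp add: nn_integral_density)
  finally show ?thesis .
qed

lemmas nn_integral_comp = nn_integral_comp_RN_h[OF nonsingular]

text \<open>Identifies a density through an integral identity over all \<open>f\<close>, a form in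
  which changes of variables can be chained; indicators recover the measures.\<close>

lemma RN_h_unique:
  assumes [measurable]: "\<psi> \<in> measurable M M" "g \<in> borel_measurable M"
    and eq: "\<And>f. f \<in> borel_measurable M \<Longrightarrow> (\<integral>\<^sup>+x. f (\<psi> x) \<partial>M) = (\<integral>\<^sup>+x. g x * f x \<partial>M)"
  shows "AE x in M. g x = RN_h M \<psi> x"
  unfolding RN_h_def
proof (rule RN_deriv_unique)
  show "density M g = distr M M \<psi>"
  proof (rule measure_eqI)
    fix A assume "A \<in> sets (density M g)"
    then have [measurable]: "A \<in> sets M" by simp
    have "emeasure (distr M M \<psi>) A = integral\<^sup>N (distr M M \<psi>) (indicator A)"
      by simp
    also have "\<dots> = (\<integral>\<^sup>+x. indicator A (\<psi> x) \<partial>M)"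
      by (subst nn_integral_distr) auto
    also have "\<dots> = emeasure (density M g) A"
      by (subst eq) (auto simp: emeasure_density)
    finally show "emeasure (density M g) A = emeasure (distr M M \<psi>) A" by simp
  qed simp
qed simp

lemma nonsingular_funpow: "nonsingular M (\<phi> ^^ n)"
proof (induction n)
  case 0
  then show ?case by (simp add: nonsingular_def distr_id id_def absolutely_continuous_def)
next
  case (Suc n)
  have [measurable]: "\<phi> ^^ n \<in> measurable M M" using Suc by (simp add: nonsingular_def)
  have m [measurable]: "\<phi> ^^ Suc n \<in> measurable M M"
    unfolding funpow_Suc_right by (rule measurable_comp[of _ _ M]) measurable
  have "absolutely_continuous M (distr M M (\<phi> ^^ Suc n))"
    unfolding absolutely_continuous_def
  proof
    fix N assume N: "N \<in> null_sets M"
    have [measurable]: "N \<in> sets M" using N by auto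
    have "AE x in M. x \<notin> N" using N by (rule AE_not_in)
    from AE_comp[OF nonsingular_AE[OF Suc this]]
    have "AE x in M. (\<phi> ^^ Suc n) x \<notin> N" by (simp add: funpow_swap1)
    then have "(\<phi> ^^ Suc n) -` N \<inter> space M \<in> null_sets M"
      using measurable_sets[OF m \<open>N \<in> sets M\<close>] by (subst AE_iff_null_sets) (auto simp: eventually_mono)
    then show "N \<in> null_sets (distr M M (\<phi> ^^ Suc n))"
      by (subst null_sets_distr_iff[OF m]) auto
  qed
  with m show ?case by (simp only: nonsingular_def)
qed

lemma funpow_measurable [measurable]: "\<phi> ^^ n \<in> measurable M M"
  using nonsingular_funpow[of n] by (simp add: nonsingular_def)

text \<open>The preimage under \<open>\<phi>\<close> of the zero set of \<open>h\<close> has as its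
  measure the integral of \<open>h\<close> over that set, which is zero. This legitimises dividing
  by \<open>sqrt (H (\<phi> x))\<close> in the phase.\<close>

lemma RN_h_pos_comp: "AE x in M. h (\<phi> x) > 0"
proof -
  let ?A = "{x \<in> space M. h x = 0}"
  have "(\<integral>\<^sup>+x. indicator ?A (\<phi> x) \<partial>M) = (\<integral>\<^sup>+x. h x * indicator ?A x \<partial>M)"
    by (rule nn_integral_comp) simp
  also have "\<dots> = (\<integral>\<^sup>+x. 0 \<partial>M)"
    by (intro nn_integral_cong) (auto simp: indicator_def)
  finally have "AE x in M. indicator ?A (\<phi> x) = (0::ennreal)"
    by (simp add: nn_integral_0_iff_AE)
  with AE_space show ?thesis
    by eventually_elim (auto simp: indicator_def zero_less_iff_neq_zero dest: measurable_space[OF phi_measurable] split: if_splits)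
qed

end

text \<open>The added condition is supplied by \<open>densely_defined_imp_RN_h_finite\<close>, which
  is proved in the smaller locale.\<close>

locale finite_RN_map = nonsingular_map +
  assumes RN_h_finite: "AE x in M. h x < \<infinity>"
begin

text \<open>Multipliers and Bochner integrals call for real values; \<open>enn2real\<close> sends
  \<infinity> to 0, which affects only a null set by \<open>RN_h_finite\<close>.\<close>

definition H :: "'a \<Rightarrow> real" where
  "H x = enn2real (h x)"

lemma H_measurable [measurable]: "H \<in> borel_measurable M"
  unfolding H_def by measurable

lemma H_nonneg [simp]: "0 \<le> H x"
  by (simp add: H_def)

lemma RN_h_eq: "AE x in M. h x = ennreal (H x)"
  using RN_h_finite by eventually_elim (simp add: H_def less_top)

text \<open>By sigma-finiteness there is a positive \<open>q\<close> with finite integral; dividing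
  it by \<open>(1 + H x) ^ k\<close> leaves a positive weight whose products with the powers of
  \<open>H\<close> up to \<open>k\<close> are integrable.\<close>

lemma ex_positive_weight:
  obtains p :: "'a \<Rightarrow> real" where "p \<in> borel_measurable M" "\<forall>x\<in>space M. 0 < p x"
    "(\<integral>\<^sup>+x. ennreal (p x * (1 + H x) ^ k) \<partial>M) < \<infinity>"
proof -
  obtain q where q [measurable]: "q \<in> borel_measurable M" "integral\<^sup>N M q \<noteq> \<infinity>"
    "\<forall>x\<in>space M. 0 < q x \<and> q x < \<infinity>"
    using Ex_finite_integrable_function by blast
  let ?p = "\<lambda>x. enn2real (q x) / (1 + H x) ^ k"
  have pos: "1 + H x > 0" for x using H_nonneg[of x] by linarith
  have "(\<integral>\<^sup>+x. ennreal (?p x * (1 + H x) ^ k) \<partial>M) = integral\<^sup>N M q"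
    by (intro nn_integral_cong) (use pos q(3) in \<open>auto simp: less_imp_neq[symmetric] less_top\<close>)
  with q(2) have "(\<integral>\<^sup>+x. ennreal (?p x * (1 + H x) ^ k) \<partial>M) < \<infinity>" by (simp add: less_top)
  moreover have "0 < ?p x" if "x \<in> space M" for x
    using that q(3) pos[of x] by (simp add: enn2real_positive_iff less_top)
  ultimately show ?thesis by (intro that[of ?p]) auto
qed

section \<open>The range algebra and conditional expectation\<close>

abbreviation range_algebra :: "'a measure" where
  "range_algebra \<equiv> vimage_algebra (space M) \<phi> M"

lemma subalgebra_range_algebra: "subalgebra M range_algebra"
  unfolding subalgebra_def
  by (auto simp: sets_vimage_algebra2[OF measurable_space[OF phi_measurable, THEN funcsetI]])

lemma phi_measurable_range_algebra [measurable]: "\<phi> \<in> measurable range_algebra M"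
  by (rule measurable_vimage_algebra1) (auto dest: measurable_space[OF phi_measurable])

text \<open>Makes \<open>cond_E\<close> meaningful. Change of variables gives
  \<open>p \<circ> \<phi>\<close> a finite integral; the sets where it is at least
  \<open>1 / n\<close> belong to the range algebra, have finite measure by Markov's inequality, and
  exhaust the space because \<open>p\<close> is positive.\<close>

lemma sigma_finite_range_algebra: "sigma_finite_subalgebra M range_algebra"
proof
  obtain p where [measurable]: "p \<in> borel_measurable M" and p: "\<forall>x\<in>space M. 0 < p x"
    and fin: "(\<integral>\<^sup>+x. ennreal (p x * (1 + H x) ^ 1) \<partial>M) < \<infinity>"
    by (rule ex_positive_weight[of 1])
  have pos: "0 < p x" if "x \<in> space M" for x using p that by blast
  define S where "S n = {x \<in> space range_algebra. 1 \<le> real n * p (\<phi> x)}" for n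
  have S [measurable]: "S n \<in> sets range_algebra" for n
    unfolding S_def by measurable
  have SM [measurable]: "S n \<in> sets M" for n
    using S subalgebra_range_algebra by (auto simp: subalgebra_def)
  have "(\<integral>\<^sup>+x. ennreal (p (\<phi> x)) \<partial>M) = (\<integral>\<^sup>+x. h x * ennreal (p x) \<partial>M)"
    by (rule nn_integral_comp) measurable
  also have "\<dots> \<le> (\<integral>\<^sup>+x. ennreal (p x * (1 + H x) ^ 1) \<partial>M)"
  proof (rule nn_integral_mono_AE)
    show "AE x in M. h x * ennreal (p x) \<le> ennreal (p x * (1 + H x) ^ 1)"
      using RN_h_eq AE_space
    proof eventually_elim
      case (elim x)
      then show ?case using pos[of x]
        by (auto simp: ennreal_mult[symmetric] algebra_simps intro!: ennreal_leI)
    qed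
  qed
  finally have pf: "(\<integral>\<^sup>+x. ennreal (p (\<phi> x)) \<partial>M) < \<infinity>" using fin by simp
  have "emeasure M (S n) < \<infinity>" for n
  proof -
    have "emeasure M (S n) = (\<integral>\<^sup>+x. indicator (S n) x \<partial>M)" by simp
    also have "\<dots> \<le> (\<integral>\<^sup>+x. of_nat n * ennreal (p (\<phi> x)) \<partial>M)"
      by (intro nn_integral_mono)
        (auto simp: S_def indicator_def ennreal_of_nat_eq_real_of_nat ennreal_mult'[symmetric] ennreal_1[symmetric]
          simp del: ennreal_1 intro!: ennreal_leI)
    also have "\<dots> = of_nat n * (\<integral>\<^sup>+x. ennreal (p (\<phi> x)) \<partial>M)"
      by (rule nn_integral_cmult) measurable
    also have "\<dots> < \<infinity>" using pf by (simp add: ennreal_mult_less_top of_nat_less_top)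
    finally show ?thesis .
  qed
  moreover have "(\<Union>n. S n) = space M"
  proof -
    have "\<exists>n. 1 \<le> real n * p (\<phi> x)" if "x \<in> space M" for x
    proof -
      have "0 < p (\<phi> x)" using that by (intro pos measurable_space[OF phi_measurable])
      then obtain n where "1 < real n * p (\<phi> x)" using reals_Archimedean3 by blast
      then show ?thesis by (auto intro: less_imp_le)
    qed
    then show ?thesis by (auto simp: S_def)
  qed
  moreover note S SM emeasure_restr_to_subalg[OF subalgebra_range_algebra]
  ultimately show "\<exists>A. countable A \<and> A \<subseteq> sets (restr_to_subalg M range_algebra) \<and>
      \<Union> A = space (restr_to_subalg M range_algebra) \<and>
      (\<forall>a\<in>A. emeasure (restr_to_subalg M range_algebra) a \<noteq> \<infinity>)"
    by (intro exI[of _ "range S"])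
      (auto simp: sets_restr_to_subalg[OF subalgebra_range_algebra] space_restr_to_subalg less_top)
qed (rule subalgebra_range_algebra)

lemma cond_E_measurable [measurable]: "cond_E M \<phi> f \<in> borel_measurable M"
  by (simp add: cond_E_def borel_measurable_nn_cond_exp2)

lemma nn_integral_cond_E:
  assumes "f \<in> borel_measurable M" "g \<in> borel_measurable M"
  shows "(\<integral>\<^sup>+x. f (\<phi> x) * cond_E M \<phi> g x \<partial>M) = (\<integral>\<^sup>+x. f (\<phi> x) * g x \<partial>M)"
  unfolding cond_E_def
  by (rule sigma_finite_subalgebra.nn_cond_exp_intg[OF sigma_finite_range_algebra]) (use assms in measurable)

text \<open>\<open>f \<circ> \<phi>\<close> is measurable for the range algebra and hence fixed by
  conditional expectation; congruence carries this over to \<open>g\<close>.\<close>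

lemma cond_E_comp:
  assumes [measurable]: "f \<in> borel_measurable M" "g \<in> borel_measurable M"
    and eq: "AE x in M. g x = f (\<phi> x)"
  shows "AE x in M. cond_E M \<phi> g x = f (\<phi> x)"
proof -
  have "AE x in M. f (\<phi> x) = cond_E M \<phi> (\<lambda>x. f (\<phi> x)) x"
    unfolding cond_E_def
    by (rule sigma_finite_subalgebra.nn_cond_exp_F_meas[OF sigma_finite_range_algebra]) measurable
  moreover have "AE x in M. cond_E M \<phi> g x = cond_E M \<phi> (\<lambda>x. f (\<phi> x)) x"
    unfolding cond_E_def
    by (rule sigma_finite_subalgebra.nn_cond_exp_cong[OF sigma_finite_range_algebra eq]) measurable
  ultimately show ?thesis by eventually_elim simp
qed

section \<open>Invariance and the moments of \<open>h\<close>\<close>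

abbreviation invariant :: bool where
  "invariant \<equiv> AE x in M. h (\<phi> x) = h x"

lemma invariant_funpow:
  assumes invariant
  shows "AE x in M. h ((\<phi> ^^ n) x) = h x"
proof (induction n)
  case (Suc n)
  from AE_comp[OF this] assms show ?case
    by eventually_elim (simp add: funpow_swap1)
qed simp

text \<open>Induction on \<open>n\<close> with \<open>f\<close> arbitrary. Removing the innermost
  \<open>\<phi>\<close> produces a factor \<open>h x\<close>; invariance replaces it by
  \<open>h ((\<phi> ^^ n) x)\<close>, and the induction hypothesis applies to the product of
  \<open>h\<close> and \<open>f\<close>.\<close>

lemma invariant_imp_RN_h_funpow:
  assumes invariant
  shows "AE x in M. RN_h M (\<phi> ^^ n) x = h x ^ n"
proof -
  have "(\<integral>\<^sup>+x. f ((\<phi> ^^ n) x) \<partial>M) = (\<integral>\<^sup>+x. h x ^ n * f x \<partial>M)"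
    if "f \<in> borel_measurable M" for f
    using that
  proof (induction n arbitrary: f)
    case (Suc n)
    note [measurable] = Suc.prems
    have "(\<integral>\<^sup>+x. f ((\<phi> ^^ Suc n) x) \<partial>M) = (\<integral>\<^sup>+x. f ((\<phi> ^^ n) (\<phi> x)) \<partial>M)"
      by (simp add: funpow_swap1)
    also have "\<dots> = (\<integral>\<^sup>+x. h x * f ((\<phi> ^^ n) x) \<partial>M)"
      by (rule nn_integral_comp) measurable
    also have "\<dots> = (\<integral>\<^sup>+x. h ((\<phi> ^^ n) x) * f ((\<phi> ^^ n) x) \<partial>M)"
      by (intro nn_integral_cong_AE) (use invariant_funpow[OF assms, of n] in eventually_elim, simp)
    also have "\<dots> = (\<integral>\<^sup>+x. h x ^ n * (h x * f x) \<partial>M)"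
      by (rule Suc.IH) measurable
    finally show ?case by (simp add: mult_ac)
  qed simp
  then have "AE x in M. h x ^ n = RN_h M (\<phi> ^^ n) x" by (intro RN_h_unique) measurable
  then show ?thesis by eventually_elim simp
qed

text \<open>The hypotheses say that \<open>E(h) = h \<circ> \<phi>\<close> and \<open>E(h\<^sup>2) = (h \<circ> \<phi>)\<^sup>2\<close>, so the conditional variance of \<open>h\<close> vanishes.
  The weight \<open>p\<close> keeps all integrals finite, so that terms may be cancelled.\<close>

lemma invariantI_moments:
  assumes m1: "\<And>g. g \<in> borel_measurable M \<Longrightarrow>
      (\<integral>\<^sup>+x. h x * g (\<phi> x) \<partial>M) = (\<integral>\<^sup>+x. h (\<phi> x) * g (\<phi> x) \<partial>M)"
    and m2: "\<And>g. g \<in> borel_measurable M \<Longrightarrow>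
      (\<integral>\<^sup>+x. h x ^ 2 * g (\<phi> x) \<partial>M) = (\<integral>\<^sup>+x. h (\<phi> x) ^ 2 * g (\<phi> x) \<partial>M)"
  shows invariant
proof -
  \<comment> \<open>Exponent 3, since moving \<open>h (\<phi> x) ^ 2\<close> off
    \<open>\<phi>\<close> adds one more factor \<open>h\<close> to the square.\<close>
  obtain p where [measurable]: "p \<in> borel_measurable M" and p: "\<forall>x\<in>space M. 0 < p x"
    and fin: "(\<integral>\<^sup>+x. ennreal (p x * (1 + H x) ^ 3) \<partial>M) < \<infinity>"
    by (rule ex_positive_weight[of 3])
  have pos: "0 < p x" if "x \<in> space M" for x using p that by blast
  define g where "g x = ennreal (p x)" for x
  have [measurable]: "g \<in> borel_measurable M" unfolding g_def by measurable
  define V where "V x = ennreal ((H x - H (\<phi> x))\<^sup>2)" for x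
  have [measurable]: "V \<in> borel_measurable M" unfolding V_def by measurable
  define c where "c = (\<integral>\<^sup>+x. h (\<phi> x) ^ 2 * g (\<phi> x) \<partial>M)"
  have "c = (\<integral>\<^sup>+x. h x * (h x ^ 2 * g x) \<partial>M)"
    unfolding c_def by (rule nn_integral_comp) measurable
  also have "\<dots> \<le> (\<integral>\<^sup>+x. ennreal (p x * (1 + H x) ^ 3) \<partial>M)"
  proof (rule nn_integral_mono_AE)
    show "AE x in M. h x * (h x ^ 2 * g x) \<le> ennreal (p x * (1 + H x) ^ 3)"
      using RN_h_eq AE_space
    proof eventually_elim
      case (elim x)
      have "H x * ((H x)\<^sup>2 * p x) = p x * H x ^ 3" by (simp add: power2_eq_square power3_eq_cube)
      also have "\<dots> \<le> p x * (1 + H x) ^ 3"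
        using pos[OF elim(2)] by (intro mult_left_mono power_mono) auto
      finally show ?case using elim pos[OF elim(2)]
        by (auto simp: g_def ennreal_mult[symmetric] ennreal_power intro!: ennreal_leI)
    qed
  qed
  finally have cf: "c < \<infinity>" using fin by simp
  \<comment> \<open>The first moment hypothesis with \<open>h x * g x\<close> in place of
    \<open>g x\<close> turns the cross term into \<open>c\<close>.\<close>
  have "(\<integral>\<^sup>+x. h x * h (\<phi> x) * g (\<phi> x) \<partial>M) = c"
    using m1[of "\<lambda>x. h x * g x"] by (simp add: c_def mult.assoc power2_eq_square)
  \<comment> \<open>Subtraction is avoided in the extended nonnegative reals: twice the cross term
    is added to the squared deviation \<open>V\<close>, and the finite \<open>2 * c\<close> is
    cancelled at the end.\<close>
  then have "(\<integral>\<^sup>+x. V x * g (\<phi> x) \<partial>M) + 2 * c =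
      (\<integral>\<^sup>+x. V x * g (\<phi> x) + 2 * (h x * h (\<phi> x) * g (\<phi> x)) \<partial>M)"
    by (simp add: nn_integral_add nn_integral_cmult)
  also have "\<dots> = (\<integral>\<^sup>+x. h x ^ 2 * g (\<phi> x) + h (\<phi> x) ^ 2 * g (\<phi> x) \<partial>M)"
  proof (rule nn_integral_cong_AE)
    show "AE x in M. V x * g (\<phi> x) + 2 * (h x * h (\<phi> x) * g (\<phi> x)) =
        h x ^ 2 * g (\<phi> x) + h (\<phi> x) ^ 2 * g (\<phi> x)"
      using RN_h_eq AE_comp[OF RN_h_eq]
    proof eventually_elim
      case (elim x)
      have "V x + 2 * (h x * h (\<phi> x)) = h x ^ 2 + h (\<phi> x) ^ 2"
      proof -
        have "V x + 2 * (h x * h (\<phi> x)) = ennreal ((H x - H (\<phi> x))\<^sup>2 + 2 * (H x * H (\<phi> x)))"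
          unfolding elim V_def by (simp add: ennreal_mult)
        also have "(H x - H (\<phi> x))\<^sup>2 + 2 * (H x * H (\<phi> x)) = (H x)\<^sup>2 + (H (\<phi> x))\<^sup>2"
          by (simp add: power2_diff)
        finally show ?thesis
          unfolding elim by (simp add: ennreal_power)
      qed
      then show ?case by (metis distrib_right mult.assoc)
    qed
  qed
  also have "\<dots> = 2 * c"
    using m2[of g] by (simp add: nn_integral_add c_def mult_2)
  finally have "(\<integral>\<^sup>+x. V x * g (\<phi> x) \<partial>M) = 0"
    using cf ennreal_add_left_cancel[of "2 * c" _ 0]
    by (auto simp: add.commute ennreal_mult_eq_top_iff)
  then have "AE x in M. V x * g (\<phi> x) = 0" by (simp add: nn_integral_0_iff_AE)
  with RN_h_eq AE_comp[OF RN_h_eq] AE_space show ?thesis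
  proof eventually_elim
    case (elim x)
    have "0 < p (\<phi> x)" using elim by (intro pos measurable_space[OF phi_measurable])
    with elim(4) have "V x = 0" by (auto simp: g_def)
    then have "(H x - H (\<phi> x))\<^sup>2 \<le> 0" unfolding V_def by (simp add: ennreal_eq_0_iff)
    then have "H x = H (\<phi> x)" by simp
    with elim show ?case by simp
  qed
qed

text \<open>Both sides of the moment identity of order \<open>n\<close> equal the integral of
  \<open>g ((\<phi> ^^ Suc n) x)\<close>: the left by the formula for \<open>n\<close>, the right by
  that for \<open>Suc n\<close> and one change of variables. Orders 1 and 2 are the two
  moments.\<close>

lemma RN_h_funpow_imp_invariant:
  assumes "\<And>n. AE x in M. RN_h M (\<phi> ^^ n) x = h x ^ n"
  shows invariant
proof (rule invariantI_moments)
  have *: "(\<integral>\<^sup>+x. f ((\<phi> ^^ n) x) \<partial>M) = (\<integral>\<^sup>+x. h x ^ n * f x \<partial>M)"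
    if [measurable]: "f \<in> borel_measurable M" for f n
    unfolding nn_integral_comp_RN_h[OF nonsingular_funpow that]
    by (intro nn_integral_cong_AE) (use assms[of n] in eventually_elim, simp)
  have "(\<integral>\<^sup>+x. h x ^ n * g (\<phi> x) \<partial>M) = (\<integral>\<^sup>+x. h (\<phi> x) ^ n * g (\<phi> x) \<partial>M)"
    if [measurable]: "g \<in> borel_measurable M" for g n
  proof -
    have "(\<integral>\<^sup>+x. h x ^ n * g (\<phi> x) \<partial>M) = (\<integral>\<^sup>+x. g ((\<phi> ^^ Suc n) x) \<partial>M)"
      using *[of "\<lambda>x. g (\<phi> x)" n] by simp
    also have "\<dots> = (\<integral>\<^sup>+x. h x * (h x ^ n * g x) \<partial>M)"
      by (subst *) (auto simp: mult_ac)
    also have "\<dots> = (\<integral>\<^sup>+x. h (\<phi> x) ^ n * g (\<phi> x) \<partial>M)"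
      by (rule nn_integral_comp[symmetric]) measurable
    finally show ?thesis .
  qed
  from this[of _ 1] this[of _ 2]
  show "g \<in> borel_measurable M \<Longrightarrow> (\<integral>\<^sup>+x. h x * g (\<phi> x) \<partial>M) = (\<integral>\<^sup>+x. h (\<phi> x) * g (\<phi> x) \<partial>M)"
    "g \<in> borel_measurable M \<Longrightarrow> (\<integral>\<^sup>+x. h x ^ 2 * g (\<phi> x) \<partial>M) = (\<integral>\<^sup>+x. h (\<phi> x) ^ 2 * g (\<phi> x) \<partial>M)" for g
    by simp_all
qed

lemma invariant_iff_RN_h_funpow:
  "invariant \<longleftrightarrow> (\<forall>n. AE x in M. RN_h M (\<phi> ^^ n) x = h x ^ n)"
  using invariant_imp_RN_h_funpow RN_h_funpow_imp_invariant by blast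

text \<open>Under invariance all functions in question are a.e. functions of
  \<open>\<phi> x\<close>, so \<open>cond_E\<close> fixes them. Conversely, the case
  \<open>n = 2\<close> becomes the second moment once \<open>RN_h M (\<phi> ^^ 2)\<close> is known
  to be the square of \<open>h\<close>.\<close>

lemma invariant_iff_cond_E_moments:
  "invariant \<longleftrightarrow> (AE x in M. cond_E M \<phi> h x = h (\<phi> x)) \<and>
    (\<forall>n. AE x in M. cond_E M \<phi> (RN_h M (\<phi> ^^ n)) x = cond_E M \<phi> h x ^ n)"
proof (intro iffI conjI allI)
  assume inv: invariant
  show E1: "AE x in M. cond_E M \<phi> h x = h (\<phi> x)"
    by (rule cond_E_comp) (use inv in \<open>auto simp: eventually_mono\<close>)
  fix n
  have "AE x in M. cond_E M \<phi> (RN_h M (\<phi> ^^ n)) x = (\<lambda>y. h y ^ n) (\<phi> x)"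
  proof (rule cond_E_comp)
    show "AE x in M. RN_h M (\<phi> ^^ n) x = h (\<phi> x) ^ n"
      using invariant_imp_RN_h_funpow[OF inv, of n] inv by eventually_elim simp
  qed measurable
  with E1 show "AE x in M. cond_E M \<phi> (RN_h M (\<phi> ^^ n)) x = cond_E M \<phi> h x ^ n"
    by eventually_elim simp
next
  assume "(AE x in M. cond_E M \<phi> h x = h (\<phi> x)) \<and>
    (\<forall>n. AE x in M. cond_E M \<phi> (RN_h M (\<phi> ^^ n)) x = cond_E M \<phi> h x ^ n)"
  then have E1: "AE x in M. cond_E M \<phi> h x = h (\<phi> x)"
    and E2: "AE x in M. cond_E M \<phi> (RN_h M (\<phi> ^^ 2)) x = cond_E M \<phi> h x ^ 2" by auto
  show invariant
  proof (rule invariantI_moments)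
    show m1: "(\<integral>\<^sup>+x. h x * g (\<phi> x) \<partial>M) = (\<integral>\<^sup>+x. h (\<phi> x) * g (\<phi> x) \<partial>M)"
      if [measurable]: "g \<in> borel_measurable M" for g
    proof -
      have "(\<integral>\<^sup>+x. h x * g (\<phi> x) \<partial>M) = (\<integral>\<^sup>+x. g (\<phi> x) * cond_E M \<phi> h x \<partial>M)"
        by (subst nn_integral_cond_E) (auto simp: mult_ac)
      also have "\<dots> = (\<integral>\<^sup>+x. h (\<phi> x) * g (\<phi> x) \<partial>M)"
        by (intro nn_integral_cong_AE) (use E1 in eventually_elim, simp add: mult_ac)
      finally show ?thesis .
    qed
    \<comment> \<open>The first moment already yields this: two changes of variables with
      \<open>m1\<close> applied in between.\<close>
    have "AE x in M. h x ^ 2 = RN_h M (\<phi> ^^ 2) x"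
    proof (rule RN_h_unique)
      fix f :: "'a \<Rightarrow> ennreal" assume [measurable]: "f \<in> borel_measurable M"
      have "(\<integral>\<^sup>+x. f ((\<phi> ^^ 2) x) \<partial>M) = (\<integral>\<^sup>+x. h x * f (\<phi> x) \<partial>M)"
        using nn_integral_comp[of "\<lambda>x. f (\<phi> x)"] by (simp add: numeral_2_eq_2)
      also have "\<dots> = (\<integral>\<^sup>+x. h x * (h x * f x) \<partial>M)"
        unfolding m1[OF \<open>f \<in> borel_measurable M\<close>] by (rule nn_integral_comp) measurable
      finally show "(\<integral>\<^sup>+x. f ((\<phi> ^^ 2) x) \<partial>M) = (\<integral>\<^sup>+x. h x ^ 2 * f x \<partial>M)"
        by (simp add: power2_eq_square mult_ac)
    qed measurable
    then show "(\<integral>\<^sup>+x. h x ^ 2 * g (\<phi> x) \<partial>M) = (\<integral>\<^sup>+x. h (\<phi> x) ^ 2 * g (\<phi> x) \<partial>M)"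
      if [measurable]: "g \<in> borel_measurable M" for g
    proof -
      have "(\<integral>\<^sup>+x. h x ^ 2 * g (\<phi> x) \<partial>M) = (\<integral>\<^sup>+x. g (\<phi> x) * RN_h M (\<phi> ^^ 2) x \<partial>M)"
        by (intro nn_integral_cong_AE)
          (use \<open>AE x in M. h x ^ 2 = RN_h M (\<phi> ^^ 2) x\<close> in eventually_elim, simp add: mult_ac)
      also have "\<dots> = (\<integral>\<^sup>+x. g (\<phi> x) * cond_E M \<phi> (RN_h M (\<phi> ^^ 2)) x \<partial>M)"
        by (subst nn_integral_cond_E) auto
      also have "\<dots> = (\<integral>\<^sup>+x. h (\<phi> x) ^ 2 * g (\<phi> x) \<partial>M)"
        by (intro nn_integral_cong_AE) (use E1 E2 in eventually_elim, simp add: mult_ac)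
      finally show ?thesis .
    qed
  qed
qed

section \<open>Invariance tested on Borel sets and Borel functions\<close>

lemma ext0_RN_h_measurable [measurable]:
  assumes "f \<in> borel_measurable Borel_Rplus"
  shows "(\<lambda>x. ext0 f (h x)) \<in> borel_measurable M"
proof -
  have [measurable]: "(\<lambda>x. enn2real (h x)) \<in> measurable M Borel_Rplus"
    by (intro measurable_restrict_space2) auto
  note [measurable] = assms
  show ?thesis unfolding ext0_def by measurable
qed

lemma indicator_measurable_Rplus:
  "\<sigma> \<in> sets Borel_Rplus \<Longrightarrow> (indicator \<sigma> :: real \<Rightarrow> ennreal) \<in> borel_measurable Borel_Rplus"
  by (rule borel_measurable_indicator)

lemma char_fn_RN_h:
  "AE x in M. char_fn \<sigma> (h x) = indicator \<sigma> (H x)"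
  using RN_h_finite by eventually_elim (auto simp: ext0_def H_def)

text \<open>The sets \<open>{0..<q}\<close> force \<open>H x \<le> H (\<phi> x)\<close>, their
  complements the reverse inequality; with \<open>q\<close> rational a single null set serves all of
  them.\<close>

lemma invariantI_char_fn:
  assumes "\<And>\<sigma>. \<sigma> \<in> sets Borel_Rplus \<Longrightarrow> AE x in M. H (\<phi> x) \<in> \<sigma> \<longrightarrow> H x \<in> \<sigma>"
  shows invariant
proof -
  \<comment> \<open>\<open>max 0 q\<close> keeps the half-line inside the space of
    \<open>Borel_Rplus\<close>.\<close>
  have 1: "{0..<q} \<in> sets Borel_Rplus" "{max 0 q..} \<in> sets Borel_Rplus" for q :: real
    by (auto simp: sets_restrict_space_iff)
  have "AE x in M. \<forall>q\<in>\<rat>. (H (\<phi> x) \<in> {0..<q} \<longrightarrow> H x \<in> {0..<q}) \<and>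
      (H (\<phi> x) \<in> {max 0 q..} \<longrightarrow> H x \<in> {max 0 q..})"
    by (subst AE_ball_countable) (use assms[OF 1(1)] assms[OF 1(2)] in \<open>auto simp: countable_rat\<close>)
  with RN_h_eq AE_comp[OF RN_h_eq] show ?thesis
  proof eventually_elim
    case (elim x)
    have "\<not> H (\<phi> x) < H x"
    proof
      assume "H (\<phi> x) < H x"
      then obtain q where "q \<in> \<rat>" "H (\<phi> x) < q" "q < H x" using Rats_dense_in_real by blast
      with elim(3) show False by fastforce
    qed
    moreover have "\<not> H x < H (\<phi> x)"
    proof
      assume "H x < H (\<phi> x)"
      then obtain q where "q \<in> \<rat>" "H x < q" "q < H (\<phi> x)" using Rats_dense_in_real by blast
      with elim(3) show False by fastforce
    qed
    ultimately show ?case using elim by simp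
  qed
qed

lemma invariant_iff_char_fn:
  "invariant \<longleftrightarrow> (\<forall>\<sigma>\<in>sets Borel_Rplus.
    AE x in M. char_fn \<sigma> (h (\<phi> x)) * char_fn \<sigma> (h x) = char_fn \<sigma> (h (\<phi> x)))"
proof
  assume invariant
  then show "\<forall>\<sigma>\<in>sets Borel_Rplus.
      AE x in M. char_fn \<sigma> (h (\<phi> x)) * char_fn \<sigma> (h x) = char_fn \<sigma> (h (\<phi> x))"
    by (auto elim!: eventually_mono simp: ext0_def indicator_def)
next
  assume R: "\<forall>\<sigma>\<in>sets Borel_Rplus.
    AE x in M. char_fn \<sigma> (h (\<phi> x)) * char_fn \<sigma> (h x) = char_fn \<sigma> (h (\<phi> x))"
  show invariant
  proof (rule invariantI_char_fn)
    fix \<sigma> assume "\<sigma> \<in> sets Borel_Rplus"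
    with R have "AE x in M. char_fn \<sigma> (h (\<phi> x)) * char_fn \<sigma> (h x) = char_fn \<sigma> (h (\<phi> x))" by blast
    with char_fn_RN_h[of \<sigma>] AE_comp[OF char_fn_RN_h[of \<sigma>]] show "AE x in M. H (\<phi> x) \<in> \<sigma> \<longrightarrow> H x \<in> \<sigma>"
      by eventually_elim (auto simp: indicator_def split: if_splits)
  qed
qed

lemma invariant_imp_cond_E_ext0:
  assumes invariant "f \<in> borel_measurable Borel_Rplus"
  shows "AE x in M. cond_E M \<phi> (\<lambda>y. ext0 f (h y)) x = ext0 f (h (\<phi> x))"
proof (rule cond_E_comp)
  show "AE x in M. ext0 f (h x) = ext0 f (h (\<phi> x))"
    using assms(1) by eventually_elim simp
qed (use assms(2) in measurable)

text \<open>The hypothesis is applied to the complement \<open>\<tau>\<close> of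
  \<open>\<sigma>\<close>. Integrated against \<open>char_fn \<sigma> (h (\<phi> x))\<close>, the
  function \<open>char_fn \<tau> (h x)\<close> may be replaced by
  \<open>char_fn \<tau> (h (\<phi> x))\<close>, and that product is zero.\<close>

lemma invariantI_cond_E_char_fn:
  assumes R: "\<And>\<sigma>. \<sigma> \<in> sets Borel_Rplus \<Longrightarrow>
    AE x in M. cond_E M \<phi> (\<lambda>y. char_fn \<sigma> (h y)) x = char_fn \<sigma> (h (\<phi> x))"
  shows invariant
proof (rule invariantI_char_fn)
  fix \<sigma> assume \<sigma>: "\<sigma> \<in> sets Borel_Rplus"
  define \<tau> where "\<tau> = {0..} - \<sigma>"
  have \<tau>: "\<tau> \<in> sets Borel_Rplus"
    using sets.compl_sets[OF \<sigma>] by (simp add: \<tau>_def)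
  have [measurable]: "(\<lambda>x. char_fn \<sigma> (h x)) \<in> borel_measurable M" "(\<lambda>x. char_fn \<tau> (h x)) \<in> borel_measurable M"
    by (auto intro!: ext0_RN_h_measurable indicator_measurable_Rplus \<sigma> \<tau>)
  have "(\<integral>\<^sup>+x. char_fn \<sigma> (h (\<phi> x)) * char_fn \<tau> (h x) \<partial>M) =
      (\<integral>\<^sup>+x. char_fn \<sigma> (h (\<phi> x)) * cond_E M \<phi> (\<lambda>y. char_fn \<tau> (h y)) x \<partial>M)"
    by (rule nn_integral_cond_E[symmetric]) measurable
  also have "\<dots> = (\<integral>\<^sup>+x. 0 \<partial>M)"
    by (intro nn_integral_cong_AE)
      (use R[OF \<tau>] in eventually_elim, auto simp: \<tau>_def ext0_def indicator_def)
  finally have "AE x in M. char_fn \<sigma> (h (\<phi> x)) * char_fn \<tau> (h x) = 0"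
    by (simp add: nn_integral_0_iff_AE)
  with char_fn_RN_h[of \<tau>] AE_comp[OF char_fn_RN_h[of \<sigma>]] show "AE x in M. H (\<phi> x) \<in> \<sigma> \<longrightarrow> H x \<in> \<sigma>"
    by eventually_elim (auto simp: \<tau>_def indicator_def split: if_splits)
qed

lemma invariant_iff_cond_E_char_fn:
  "invariant \<longleftrightarrow> (\<forall>\<sigma>\<in>sets Borel_Rplus.
    AE x in M. cond_E M \<phi> (\<lambda>y. char_fn \<sigma> (h y)) x = char_fn \<sigma> (h (\<phi> x)))"
  using invariant_imp_cond_E_ext0 indicator_measurable_Rplus invariantI_cond_E_char_fn by blast

text \<open>Indicators are among the functions \<open>f\<close>, so the converse reduces to
  characteristic functions.\<close>

lemma invariant_iff_cond_E_ext0: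
  "invariant \<longleftrightarrow> (\<forall>f\<in>borel_measurable Borel_Rplus.
    AE x in M. cond_E M \<phi> (\<lambda>y. ext0 f (h y)) x = ext0 f (h (\<phi> x)))"
  using invariant_imp_cond_E_ext0 indicator_measurable_Rplus invariantI_cond_E_char_fn by blast

end

section \<open>The polar decomposition of the composition operator\<close>

context nonsingular_map
begin

text \<open>Norm convergence gives a.e. convergence along a subsequence, and nonsingularity allows
  an a.e. limit to be composed with \<open>\<phi>\<close>. The limit of the images is therefore the
  image of the limit.\<close>

lemma closed_op_comp_op: "closed_op (L2 M) (comp_op M \<phi>)"
  unfolding closed_op_def
proof (intro allI impI, elim conjE)
  fix s t x y
  assume st: "\<forall>n::nat. (s n, t n) \<in> comp_op M \<phi>" and "x \<in> hcarrier (L2 M)" "y \<in> hcarrier (L2 M)"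
    and s: "(\<lambda>n. hdist (L2 M) (s n) x) \<longlonglongrightarrow> 0" and t: "(\<lambda>n. hdist (L2 M) (t n) y) \<longlonglongrightarrow> 0"
  then obtain a b where a: "x = L2_class M a" "sq_integrable M a" and b: "y = L2_class M b" "sq_integrable M b"
    unfolding hcarrier_L2 by blast
  from st have "\<forall>n. \<exists>f. s n = L2_class M f \<and> t n = L2_class M (f \<circ> \<phi>) \<and>
      sq_integrable M f \<and> sq_integrable M (f \<circ> \<phi>)"
    unfolding comp_op_def by blast
  then obtain f where f: "\<And>n. s n = L2_class M (f n)" "\<And>n. t n = L2_class M (f n \<circ> \<phi>)"
      "\<And>n. sq_integrable M (f n)" "\<And>n. sq_integrable M (f n \<circ> \<phi>)"
    by metis
  \<comment> \<open>Convergence in the norm means that the squared deviations tend to zero in mean,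
    and a sequence tending to zero in mean has an a.e. convergent subsequence.\<close>
  have conv: "\<exists>r. strict_mono (r::nat\<Rightarrow>nat) \<and> (AE z in M. (\<lambda>n. g (r n) z) \<longlonglongrightarrow> c z)"
    if g: "\<And>n. sq_integrable M (g n)" and c: "sq_integrable M c"
      and lim: "(\<lambda>n. hdist (L2 M) (L2_class M (g n)) (L2_class M c)) \<longlonglongrightarrow> 0" for g :: "nat \<Rightarrow> 'a \<Rightarrow> complex" and c
  proof -
    have "(\<lambda>n. (hdist (L2 M) (L2_class M (g n)) (L2_class M c))\<^sup>2) \<longlonglongrightarrow> 0\<^sup>2"
      using lim by (rule tendsto_power)
    moreover have "(hdist (L2 M) (L2_class M (g n)) (L2_class M c))\<^sup>2 = (LINT z|M. norm ((cmod (g n z - c z))\<^sup>2))" for n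
      by (simp add: hdist_L2_class[OF g c] integral_nonneg_AE)
    ultimately have "(\<lambda>n. LINT z|M. norm ((cmod (g n z - c z))\<^sup>2)) \<longlonglongrightarrow> 0" by simp
    moreover have "integrable M (\<lambda>z. (cmod (g n z - c z))\<^sup>2)" for n
      using sq_integrable_diff[OF g c] by (simp add: sq_integrable_def)
    ultimately obtain r where r: "strict_mono (r::nat\<Rightarrow>nat)" "AE z in M. (\<lambda>n. (cmod (g (r n) z - c z))\<^sup>2) \<longlonglongrightarrow> 0"
      using tendsto_L1_AE_subseq[of M "\<lambda>n z. (cmod (g n z - c z))\<^sup>2"] by blast
    from r(2) have "AE z in M. (\<lambda>n. g (r n) z) \<longlonglongrightarrow> c z"
    proof eventually_elim
      case (elim z)
      from tendsto_real_sqrt[OF this] show ?case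
        by (simp add: tendsto_norm_zero_iff LIM_zero_iff)
    qed
    with r(1) show ?thesis by blast
  qed
  obtain r where r: "strict_mono r" "AE z in M. (\<lambda>n. f (r n) z) \<longlonglongrightarrow> a z"
    using conv[of f a] f a s by auto
  \<comment> \<open>The second subsequence is drawn from the first, so that both limits hold along
    it.\<close>
  have "(\<lambda>n. hdist (L2 M) (L2_class M (f (r n) \<circ> \<phi>)) (L2_class M b)) \<longlonglongrightarrow> 0"
    using LIMSEQ_subseq_LIMSEQ[OF t r(1)] by (simp add: comp_def f b)
  then obtain r' where r': "strict_mono r'" "AE z in M. (\<lambda>n. (f (r (r' n)) \<circ> \<phi>) z) \<longlonglongrightarrow> b z"
    using conv[of "\<lambda>n. f (r n) \<circ> \<phi>" b] f b by auto
  have ae: "AE z in M. a (\<phi> z) = b z"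
    using AE_comp[OF r(2)] r'(2)
  proof eventually_elim
    case (elim z)
    from LIMSEQ_subseq_LIMSEQ[OF elim(1) r'(1)] have "(\<lambda>n. (f (r (r' n)) \<circ> \<phi>) z) \<longlonglongrightarrow> a (\<phi> z)"
      by (simp add: comp_def)
    with elim(2) show ?case using LIMSEQ_unique by blast
  qed
  note [measurable] = a(2)[THEN sq_integrable_measurable] b(2)[THEN sq_integrable_measurable]
  have "sq_integrable M (\<lambda>z. a (\<phi> z)) \<longleftrightarrow> sq_integrable M b"
    by (rule sq_integrable_cong_AE[OF _ _ ae]) measurable
  then show "(x, y) \<in> comp_op M \<phi>"
    unfolding comp_op_eq_wcomp_op a(1)
    using wcomp_op_iff[OF nonsingular _ a(2), of "\<lambda>_. 1"] b L2_class_cong[OF ae] by simp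
qed

text \<open>A function \<open>g\<close> in the domain has finite integral of \<open>h\<close> times
  its squared modulus, so it vanishes a.e. where \<open>h\<close> is infinite. A function
  \<open>f\<close> living on that set then has distance at least its norm from the domain, and
  density forces it to be zero.\<close>

lemma densely_defined_imp_RN_h_finite:
  assumes "densely_defined (L2 M) (comp_op M \<phi>)"
  shows "AE x in M. h x < \<infinity>"
proof -
  obtain q where q [measurable]: "q \<in> borel_measurable M" "integral\<^sup>N M q \<noteq> \<infinity>"
    "\<forall>x\<in>space M. 0 < q x \<and> q x < \<infinity>"
    using Ex_finite_integrable_function by blast
  \<comment> \<open>The square root of an integrable positive function is square integrable, and it
    vanishes nowhere on the set where \<open>h\<close> is infinite; \<open>f = 0\<close> a.e. thus
    makes that set null.\<close>
  define f where "f x = (if h x = \<infinity> then complex_of_real (sqrt (enn2real (q x))) else 0)" for x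
  have [measurable]: "f \<in> borel_measurable M" unfolding f_def by measurable
  have f: "sq_integrable M f"
  proof -
    have "(\<integral>\<^sup>+x. ennreal ((cmod (f x))\<^sup>2) \<partial>M) \<le> integral\<^sup>N M q"
      by (intro nn_integral_mono) (use q(3) in \<open>auto simp: f_def less_top\<close>)
    also have "\<dots> < \<infinity>" using q(2) by (simp add: less_top)
    finally show ?thesis by (simp add: sq_integrable_def integrable_iff_bounded)
  qed
  have le: "hnorm (L2 M) (L2_class M f) \<le> hdist (L2 M) (L2_class M f) y"
    if "y \<in> Domain (comp_op M \<phi>)" for y
  proof -
    obtain g where g: "y = L2_class M g" "sq_integrable M g" "sq_integrable M (g \<circ> \<phi>)"
      using \<open>y \<in> Domain (comp_op M \<phi>)\<close> by (auto simp: comp_op_def)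
    note [measurable] = g(2)[THEN sq_integrable_measurable]
    have "(\<integral>\<^sup>+x. h x * ennreal ((cmod (g x))\<^sup>2) \<partial>M) = (\<integral>\<^sup>+x. ennreal ((cmod (g (\<phi> x)))\<^sup>2) \<partial>M)"
      by (rule nn_integral_comp[symmetric]) measurable
    also have "\<dots> < \<infinity>"
      using g(3) by (simp add: sq_integrable_def integrable_iff_bounded)
    finally have "AE x in M. h x * ennreal ((cmod (g x))\<^sup>2) \<noteq> \<infinity>"
      by (intro nn_integral_PInf_AE) auto
    then have "AE x in M. (cmod (f x))\<^sup>2 \<le> (cmod (f x - g x))\<^sup>2"
      by eventually_elim (auto simp: f_def ennreal_mult_eq_top_iff)
    then show ?thesis
      unfolding g(1) hnorm_L2_class[OF f] hdist_L2_class[OF f g(2)]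
      using f sq_integrable_diff[OF f g(2)]
      by (intro real_sqrt_le_mono integral_mono_AE) (auto simp: sq_integrable_def)
  qed
  have "hnorm (L2 M) (L2_class M f) < e" if "e > 0" for e
  proof -
    have "L2_class M f \<in> hcarrier (L2 M)" using f by (auto simp: hcarrier_L2)
    with assms that obtain y where "y \<in> Domain (comp_op M \<phi>)" "hdist (L2 M) (L2_class M f) y < e"
      unfolding densely_defined_def by blast
    with le[of y] show ?thesis by linarith
  qed
  then have "hnorm (L2 M) (L2_class M f) \<le> 0" by (meson less_irrefl not_le)
  then have "(LINT x|M. (cmod (f x))\<^sup>2) \<le> 0" by (simp add: hnorm_L2_class[OF f])
  then have "(LINT x|M. (cmod (f x))\<^sup>2) = 0" by (simp add: order_antisym integral_nonneg_AE)
  then have "AE x in M. (cmod (f x))\<^sup>2 = 0"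
    using f by (subst (asm) integral_nonneg_eq_0_iff_AE) (auto simp: sq_integrable_def)
  with AE_space show ?thesis
  proof eventually_elim
    case (elim x)
    then have "0 < enn2real (q x)" using q(3) by (simp add: enn2real_positive_iff less_top)
    with elim show ?case by (auto simp: f_def less_top split: if_splits)
  qed
qed

end

section \<open>Change of variables with the real density, and the modulus\<close>

context finite_RN_map
begin

lemma distr_eq_density_H: "distr M M \<phi> = density M (\<lambda>x. ennreal (H x))"
proof -
  have "distr M M \<phi> = density M h"
    using nonsingular density_RN_deriv[of "distr M M \<phi>"] by (simp add: nonsingular_def RN_h_def)
  also have "\<dots> = density M (\<lambda>x. ennreal (H x))"
    by (rule density_cong) (use RN_h_eq in auto)
  finally show ?thesis .
qed

lemma integral_comp:
  fixes f :: "'a \<Rightarrow> 'b::{banach, second_countable_topology}"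
  assumes [measurable]: "f \<in> borel_measurable M"
  shows "(LINT x|M. f (\<phi> x)) = (LINT x|M. H x *\<^sub>R f x)"
  using integral_distr[of \<phi> M M f] integral_density[of f M H]
  by (simp add: distr_eq_density_H)

lemma integrable_comp:
  fixes f :: "'a \<Rightarrow> 'b::{banach, second_countable_topology}"
  assumes [measurable]: "f \<in> borel_measurable M"
  shows "integrable M (\<lambda>x. f (\<phi> x)) \<longleftrightarrow> integrable M (\<lambda>x. H x *\<^sub>R f x)"
  using integrable_distr_eq[of \<phi> M M f] integrable_density[of f M H]
  by (simp add: distr_eq_density_H)

lemma cmod_sqrt_H_square: "(cmod (complex_of_real (sqrt (H x)) * z))\<^sup>2 = H x * (cmod z)\<^sup>2"
  by (simp add: norm_mult power_mult_distrib)

text \<open>Either side says that \<open>H x * (cmod (g x))\<^sup>2\<close> is integrable. This is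
  why the composition operator and multiplication by \<open>sqrt (H x)\<close> share their
  domain.\<close>

lemma sq_integrable_comp_iff:
  assumes [measurable]: "g \<in> borel_measurable M"
  shows "sq_integrable M (\<lambda>x. g (\<phi> x)) \<longleftrightarrow> sq_integrable M (\<lambda>x. complex_of_real (sqrt (H x)) * g x)"
  using integrable_comp[of "\<lambda>x. (cmod (g x))\<^sup>2"]
  by (simp add: sq_integrable_def cmod_sqrt_H_square del: norm_mult)

text \<open>Places the domain of multiplication by \<open>H\<close> inside that of its square root,
  by \<open>sqrt (H x) \<le> 1 + H x\<close>.\<close>

lemma sq_integrable_sqrt_H:
  assumes "sq_integrable M f" "sq_integrable M (\<lambda>x. complex_of_real (H x) * f x)"
  shows "sq_integrable M (\<lambda>x. complex_of_real (sqrt (H x)) * f x)"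
proof (rule sq_integrable_bound[OF sq_integrable_add[OF assms]])
  note [measurable] = assms(1)[THEN sq_integrable_measurable]
  show "(\<lambda>x. complex_of_real (sqrt (H x)) * f x) \<in> borel_measurable M" by measurable
  have "sqrt (H x) \<le> 1 + H x" for x
    by (rule real_le_lsqrt) (auto simp: power2_eq_square algebra_simps)
  moreover have "f x + complex_of_real (H x) * f x = complex_of_real (1 + H x) * f x" for x
    by (simp add: algebra_simps)
  moreover have "\<bar>1 + H x\<bar> = 1 + H x" for x by (simp add: add_nonneg_nonneg)
  ultimately show "AE x in M. cmod (complex_of_real (sqrt (H x)) * f x) \<le> cmod (f x + complex_of_real (H x) * f x)"
    by (simp only: norm_mult norm_of_real) (simp add: mult_right_mono)
qed

lemmas comp_op_iff = wcomp_op_iff[OF nonsingular borel_measurable_const[of 1], folded comp_op_eq_wcomp_op, simplified]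
lemmas mult_op_iff = wcomp_op_iff[OF nonsingular_ident]

text \<open>Change of variables turns the inner product of \<open>k \<circ> \<phi>\<close> and
  \<open>f \<circ> \<phi>\<close> into the integral of \<open>H x * k x * cnj (f x)\<close>. Every
  \<open>k\<close> in the domain of multiplication by \<open>H\<close> lies in the domain of the
  composition operator, so \<open>AE_eq_mult_of_inner_eq\<close> applies.\<close>

lemma adjoint_mult_comp_op: "adjoint_op (L2 M) (comp_op M \<phi>) \<bullet>\<^sub>o comp_op M \<phi> = mult_op M H"
proof (intro equalityI subrelI)
  fix u v assume "(u, v) \<in> adjoint_op (L2 M) (comp_op M \<phi>) \<bullet>\<^sub>o comp_op M \<phi>"
  then obtain z where uz: "(u, z) \<in> comp_op M \<phi>" and zv: "(z, v) \<in> adjoint_op (L2 M) (comp_op M \<phi>)"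
    by (auto simp: op_mult_def)
  then obtain f g where f: "u = L2_class M f" "sq_integrable M f" and z: "z = L2_class M (\<lambda>x. f (\<phi> x))"
      "sq_integrable M (\<lambda>x. f (\<phi> x))" and g: "v = L2_class M g" "sq_integrable M g"
    by (auto simp: comp_op_def adjoint_op_def hcarrier_L2 comp_def)
  note [measurable] = f(2)[THEN sq_integrable_measurable] g(2)[THEN sq_integrable_measurable]
  have ae: "AE x in M. complex_of_real (H x) * f x = g x"
  proof (rule AE_eq_mult_of_inner_eq)
    fix k assume k: "sq_integrable M k" "sq_integrable M (\<lambda>x. complex_of_real (H x) * k x)"
    note [measurable] = k(1)[THEN sq_integrable_measurable]
    have k': "sq_integrable M (\<lambda>x. k (\<phi> x))"
      using sq_integrable_sqrt_H[OF k] by (simp add: sq_integrable_comp_iff)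
    have "(L2_class M k, L2_class M (\<lambda>x. k (\<phi> x))) \<in> comp_op M \<phi>"
      using k k' by (simp add: comp_op_iff)
    with zv have "hinner (L2 M) (L2_class M (\<lambda>x. k (\<phi> x))) z = hinner (L2 M) (L2_class M k) v"
      by (auto simp: adjoint_op_def)
    then have "(LINT x|M. k (\<phi> x) * cnj (f (\<phi> x))) = (LINT x|M. k x * cnj (g x))"
      using k k' f z g by (simp add: L2_inner_class)
    then show "(LINT x|M. complex_of_real (H x) * k x * cnj (f x)) = (LINT x|M. k x * cnj (g x))"
      using integral_comp[of "\<lambda>x. k x * cnj (f x)"] by (simp add: scaleR_conv_of_real mult.assoc)
  qed (use f g in auto)
  have "sq_integrable M (\<lambda>x. complex_of_real (H x) * f x) \<longleftrightarrow> sq_integrable M g"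
    by (rule sq_integrable_cong_AE[OF _ _ ae]) measurable
  then show "(u, v) \<in> mult_op M H"
    using f g L2_class_cong[OF ae] by (simp add: mult_op_iff)
next
  fix u v assume uv: "(u, v) \<in> mult_op M H"
  then obtain f where f: "u = L2_class M f" "sq_integrable M f"
    "v = L2_class M (\<lambda>x. complex_of_real (H x) * f x)" "sq_integrable M (\<lambda>x. complex_of_real (H x) * f x)"
    by (auto simp: wcomp_op_def)
  note [measurable] = f(2)[THEN sq_integrable_measurable]
  have f': "sq_integrable M (\<lambda>x. f (\<phi> x))"
    using sq_integrable_sqrt_H[OF f(2,4)] by (simp add: sq_integrable_comp_iff)
  have "hinner (L2 M) y (L2_class M (\<lambda>x. f (\<phi> x))) = hinner (L2 M) x v" if "(x, y) \<in> comp_op M \<phi>" for x y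
  proof -
    obtain k where k: "x = L2_class M k" "sq_integrable M k"
      "y = L2_class M (\<lambda>x. k (\<phi> x))" "sq_integrable M (\<lambda>x. k (\<phi> x))"
      using \<open>(x, y) \<in> comp_op M \<phi>\<close> by (auto simp: comp_op_def comp_def)
    note [measurable] = k(2)[THEN sq_integrable_measurable]
    show ?thesis
      using k f f' integral_comp[of "\<lambda>x. k x * cnj (f x)"]
      by (simp add: L2_inner_class scaleR_conv_of_real mult_ac)
  qed
  then have "(L2_class M (\<lambda>x. f (\<phi> x)), v) \<in> adjoint_op (L2 M) (comp_op M \<phi>)"
    using f f' by (auto simp: adjoint_op_def hcarrier_L2)
  moreover have "(u, L2_class M (\<lambda>x. f (\<phi> x))) \<in> comp_op M \<phi>"
    using f f' by (simp add: comp_op_iff)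
  ultimately show "(u, v) \<in> adjoint_op (L2 M) (comp_op M \<phi>) \<bullet>\<^sub>o comp_op M \<phi>"
    by (auto simp: op_mult_def)
qed

lemma sqrt_H_mult: "complex_of_real (sqrt (H x)) * (complex_of_real (sqrt (H x)) * z) = complex_of_real (H x) * z"
  by (simp add: mult.assoc[symmetric] of_real_mult[symmetric] del: of_real_mult)

lemma mult_sqrt_H_squared: "mult_op M (\<lambda>x. sqrt (H x)) \<bullet>\<^sub>o mult_op M (\<lambda>x. sqrt (H x)) = mult_op M H"
proof (intro equalityI subrelI)
  fix u v assume "(u, v) \<in> mult_op M (\<lambda>x. sqrt (H x)) \<bullet>\<^sub>o mult_op M (\<lambda>x. sqrt (H x))"
  then obtain z where uz: "(u, z) \<in> mult_op M (\<lambda>x. sqrt (H x))" and zv: "(z, v) \<in> mult_op M (\<lambda>x. sqrt (H x))"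
    by (auto simp: op_mult_def)
  from uz obtain f where f: "u = L2_class M f" "sq_integrable M f"
    "z = L2_class M (\<lambda>x. complex_of_real (sqrt (H x)) * f x)" "sq_integrable M (\<lambda>x. complex_of_real (sqrt (H x)) * f x)"
    by (auto simp: wcomp_op_def)
  from zv show "(u, v) \<in> mult_op M H"
    unfolding f(1,3) by (simp add: mult_op_iff f(2,4) sqrt_H_mult)
next
  fix u v assume "(u, v) \<in> mult_op M H"
  then obtain f where f: "u = L2_class M f" "sq_integrable M f"
    "v = L2_class M (\<lambda>x. complex_of_real (H x) * f x)" "sq_integrable M (\<lambda>x. complex_of_real (H x) * f x)"
    by (auto simp: wcomp_op_def)
  note s = sq_integrable_sqrt_H[OF f(2,4)]
  have "(u, L2_class M (\<lambda>x. complex_of_real (sqrt (H x)) * f x)) \<in> mult_op M (\<lambda>x. sqrt (H x))"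
    using s f by (simp add: mult_op_iff)
  moreover have "(L2_class M (\<lambda>x. complex_of_real (sqrt (H x)) * f x), v) \<in> mult_op M (\<lambda>x. sqrt (H x))"
    using s f by (simp add: mult_op_iff sqrt_H_mult)
  ultimately show "(u, v) \<in> mult_op M (\<lambda>x. sqrt (H x)) \<bullet>\<^sub>o mult_op M (\<lambda>x. sqrt (H x))"
    by (auto simp: op_mult_def)
qed

lemma Domain_comp_op: "Domain (comp_op M \<phi>) = Domain (mult_op M (\<lambda>x. sqrt (H x)))"
proof -
  have "sq_integrable M f \<Longrightarrow> sq_integrable M (f \<circ> \<phi>) \<longleftrightarrow>
      sq_integrable M (\<lambda>x. complex_of_real (sqrt (H x)) * f x)" for f
    using sq_integrable_comp_iff[of f] by (simp add: comp_def sq_integrable_measurable)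
  then show ?thesis by (fastforce simp: comp_op_def wcomp_op_def Domain_iff)
qed

lemma is_modulus_comp_op:
  assumes "densely_defined (L2 M) (comp_op M \<phi>)"
  shows "is_modulus (L2 M) (comp_op M \<phi>) (mult_op M (\<lambda>x. sqrt (H x)))"
  unfolding is_modulus_def selfadjoint_op_def
proof (intro conjI)
  show "densely_defined (L2 M) (mult_op M (\<lambda>x. sqrt (H x)))"
    using assms by (simp add: densely_defined_def Domain_comp_op)
qed (simp_all add: linear_op_wcomp_op nonsingular_ident adjoint_op_mult_op positive_op_mult_op
    mult_sqrt_H_squared adjoint_mult_comp_op)

section \<open>The phase as a partial isometry\<close>

abbreviation phase_op :: "('a \<Rightarrow> complex) set operator" where
  "phase_op \<equiv> wcomp_op M (\<lambda>x. 1 / sqrt (H (\<phi> x))) \<phi>"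

lemmas phase_op_iff = wcomp_op_iff[OF nonsingular, of "\<lambda>x. 1 / sqrt (H (\<phi> x))"]

text \<open>Hence the default value \<open>1 / 0 = 0\<close> in the weight of
  \<open>phase_op\<close> is met only on a null set.\<close>

lemma H_pos_comp: "AE x in M. H (\<phi> x) > 0"
  using RN_h_pos_comp AE_comp[OF RN_h_eq] by eventually_elim simp

text \<open>The image of \<open>f\<close> is \<open>g \<circ> \<phi>\<close> with \<open>g\<close>
  the quotient of \<open>f\<close> by \<open>sqrt (H x)\<close>. Change of variables multiplies the
  squared modulus of \<open>g\<close> by \<open>H\<close>, which restores that of \<open>f\<close>
  off the zero set of \<open>H\<close> and gives 0 on it.\<close>

lemma
  assumes f: "sq_integrable M f"
  shows sq_integrable_phase: "sq_integrable M (\<lambda>x. complex_of_real (1 / sqrt (H (\<phi> x))) * f (\<phi> x))"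
    and integral_phase: "(LINT x|M. (cmod (complex_of_real (1 / sqrt (H (\<phi> x))) * f (\<phi> x)))\<^sup>2) =
      (LINT x|M. (cmod (if H x = 0 then 0 else f x))\<^sup>2)"
proof -
  note [measurable] = f[THEN sq_integrable_measurable]
  define g where "g x = complex_of_real (1 / sqrt (H x)) * f x" for x
  have [measurable]: "g \<in> borel_measurable M" unfolding g_def by measurable
  have eq: "complex_of_real (sqrt (H x)) * g x = (if H x = 0 then 0 else f x)" for x
    by (simp add: g_def)
  have "sq_integrable M (\<lambda>x. if H x = 0 then 0 else f x)"
    by (rule sq_integrable_bound[OF f]) auto
  then show "sq_integrable M (\<lambda>x. complex_of_real (1 / sqrt (H (\<phi> x))) * f (\<phi> x))"
    using sq_integrable_comp_iff[of g] unfolding eq by (simp add: g_def)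
  have "(LINT x|M. (cmod (g (\<phi> x)))\<^sup>2) = (LINT x|M. (cmod (if H x = 0 then 0 else f x))\<^sup>2)"
    using integral_comp[of "\<lambda>x. (cmod (g x))\<^sup>2"] unfolding eq[symmetric] cmod_sqrt_H_square by simp
  then show "(LINT x|M. (cmod (complex_of_real (1 / sqrt (H (\<phi> x))) * f (\<phi> x)))\<^sup>2) =
      (LINT x|M. (cmod (if H x = 0 then 0 else f x))\<^sup>2)"
    by (simp add: g_def)
qed

lemma phase_op_class:
  "sq_integrable M f \<Longrightarrow> (L2_class M f, v) \<in> phase_op \<longleftrightarrow>
    v = L2_class M (\<lambda>x. complex_of_real (1 / sqrt (H (\<phi> x))) * f (\<phi> x))"
  using phase_op_iff[of f v] sq_integrable_phase[of f] by simp

text \<open>\<open>f \<circ> \<phi>\<close> vanishes a.e. exactly when \<open>f\<close> vanishes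
  a.e. for the image measure, whose density is \<open>H\<close>.\<close>

lemma comp_vanishes_iff: "(AE x in M. f (\<phi> x) = 0) \<longleftrightarrow> (AE x in M. H x \<noteq> 0 \<longrightarrow> f x = 0)"
  if [measurable]: "f \<in> borel_measurable M" for f :: "'a \<Rightarrow> complex"
proof -
  have "(AE x in M. f (\<phi> x) = 0) \<longleftrightarrow> (AE x in distr M M \<phi>. f x = 0)"
    by (simp add: AE_distr_iff)
  also have "\<dots> \<longleftrightarrow> (AE x in M. H x \<noteq> 0 \<longrightarrow> f x = 0)"
    unfolding distr_eq_density_H by (simp add: AE_density less_le[of 0] eq_commute[of 0])
  finally show ?thesis .
qed

lemma op_kernel_comp_op:
  "op_kernel (L2 M) (comp_op M \<phi>) = {L2_class M f |f. sq_integrable M f \<and> (AE x in M. H x \<noteq> 0 \<longrightarrow> f x = 0)}"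
proof -
  have "(L2_class M f, hzero (L2 M)) \<in> comp_op M \<phi> \<longleftrightarrow> (AE x in M. H x \<noteq> 0 \<longrightarrow> f x = 0)"
    if f: "sq_integrable M f" for f
  proof -
    note [measurable] = f[THEN sq_integrable_measurable]
    have "(L2_class M f, hzero (L2 M)) \<in> comp_op M \<phi> \<longleftrightarrow> (AE x in M. f (\<phi> x) = 0)"
      using L2_class_eq_zero_iff[of M "\<lambda>x. f (\<phi> x)"]
        sq_integrable_cong_AE[of "\<lambda>x. f (\<phi> x)" M "\<lambda>_. 0"] sq_integrable_zero[of M]
      by (auto simp: comp_op_iff[OF f])
    then show ?thesis by (simp add: comp_vanishes_iff)
  qed
  moreover have "u \<in> op_kernel (L2 M) (comp_op M \<phi>) \<Longrightarrow> \<exists>f. u = L2_class M f \<and> sq_integrable M f" for u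
    by (auto simp: op_kernel_def comp_op_def)
  ultimately show ?thesis by (force simp: op_kernel_def)
qed

text \<open>The weight of the phase is a.e. nonzero, so it does not change which classes are mapped
  to zero.\<close>

lemma op_kernel_phase_op: "op_kernel (L2 M) phase_op = op_kernel (L2 M) (comp_op M \<phi>)"
proof -
  have "(L2_class M f, hzero (L2 M)) \<in> phase_op \<longleftrightarrow> (AE x in M. H x \<noteq> 0 \<longrightarrow> f x = 0)"
    if f: "sq_integrable M f" for f
  proof -
    note [measurable] = f[THEN sq_integrable_measurable]
    have "(L2_class M f, hzero (L2 M)) \<in> phase_op \<longleftrightarrow>
        (AE x in M. complex_of_real (1 / sqrt (H (\<phi> x))) * f (\<phi> x) = 0)"
      using L2_class_eq_zero_iff[OF sq_integrable_phase[OF f]] by (auto simp: phase_op_class[OF f])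
    also have "\<dots> \<longleftrightarrow> (AE x in M. f (\<phi> x) = 0)"
    proof
      assume "AE x in M. complex_of_real (1 / sqrt (H (\<phi> x))) * f (\<phi> x) = 0"
      with H_pos_comp show "AE x in M. f (\<phi> x) = 0" by eventually_elim auto
    qed auto
    finally show ?thesis by (simp add: comp_vanishes_iff)
  qed
  moreover have "u \<in> op_kernel (L2 M) phase_op \<Longrightarrow> \<exists>f. u = L2_class M f \<and> sq_integrable M f" for u
    by (auto simp: op_kernel_def wcomp_op_def)
  ultimately show ?thesis unfolding op_kernel_comp_op by (force simp: op_kernel_def)
qed

text \<open>The image of \<open>f\<close> has the norm of \<open>f\<close> cut off to the set where
  \<open>H\<close> is nonzero. This bounds the operator by 1, with equality of norms once
  \<open>f\<close> vanishes where \<open>H\<close> does.\<close>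

lemma partial_isometry_phase_op: "partial_isometry (L2 M) phase_op"
  unfolding partial_isometry_def
proof
  have hn: "hnorm (L2 M) v = sqrt (LINT x|M. (cmod (if H x = 0 then 0 else f x))\<^sup>2)"
    if "(L2_class M f, v) \<in> phase_op" and f: "sq_integrable M f" for f v
    using that(1) unfolding phase_op_class[OF f]
    by (simp only: hnorm_L2_class[OF sq_integrable_phase[OF f]] integral_phase[OF f])
  show "bounded_op (L2 M) phase_op"
    unfolding bounded_op_def
  proof (intro conjI exI[of _ 1])
    show "linear_op (L2 M) phase_op" by (rule linear_op_wcomp_op[OF nonsingular]) measurable
    show "Domain phase_op = hcarrier (L2 M)"
      using sq_integrable_phase by (fastforce simp: wcomp_op_def hcarrier_L2 Domain_iff)
    have "hnorm (L2 M) v \<le> hnorm (L2 M) (L2_class M f)"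
      if fv: "(L2_class M f, v) \<in> phase_op" and f: "sq_integrable M f" for f v
    proof -
      note [measurable] = f[THEN sq_integrable_measurable]
      have "sq_integrable M (\<lambda>x. if H x = 0 then 0 else f x)"
        by (rule sq_integrable_bound[OF f]) auto
      then show ?thesis
        unfolding hn[OF fv f] hnorm_L2_class[OF f] using f
        by (intro real_sqrt_le_mono integral_mono_AE) (auto simp: sq_integrable_def)
    qed
    then show "\<forall>(x, y)\<in>phase_op. hnorm (L2 M) y \<le> 1 * hnorm (L2 M) x"
      by (force simp: wcomp_op_def)
  qed
  have "hnorm (L2 M) v = hnorm (L2 M) (L2_class M f)"
    if fv: "(L2_class M f, v) \<in> phase_op" and f: "sq_integrable M f"
      and orth: "\<forall>z\<in>op_kernel (L2 M) phase_op. hinner (L2 M) (L2_class M f) z = 0" for f v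
  proof -
    note [measurable] = f[THEN sq_integrable_measurable]
    \<comment> \<open>The part of \<open>f\<close> on the zero set of \<open>H\<close> belongs to
      the kernel; orthogonality to it makes this part vanish.\<close>
    define z where "z x = (if H x = 0 then f x else 0)" for x
    have z: "sq_integrable M z"
      unfolding z_def by (rule sq_integrable_bound[OF f]) auto
    have "L2_class M z \<in> op_kernel (L2 M) phase_op"
      unfolding op_kernel_phase_op op_kernel_comp_op using z by (auto simp: z_def)
    with orth have "hinner (L2 M) (L2_class M f) (L2_class M z) = 0" by blast
    moreover have "f x * cnj (z x) = z x * cnj (z x)" for x by (simp add: z_def)
    ultimately have "hinner (L2 M) (L2_class M z) (L2_class M z) = 0"
      using f z by (simp add: L2_inner_class)
    then have "(LINT x|M. (cmod (z x))\<^sup>2) = 0" by (simp add: L2_inner_self[OF z])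
    then have "AE x in M. (cmod (z x))\<^sup>2 = 0"
      using z by (subst (asm) integral_nonneg_eq_0_iff_AE) (auto simp: sq_integrable_def)
    then have "AE x in M. (cmod (if H x = 0 then 0 else f x))\<^sup>2 = (cmod (f x))\<^sup>2"
      by eventually_elim (auto simp: z_def split: if_splits)
    then show ?thesis
      unfolding hn[OF fv f] hnorm_L2_class[OF f]
      by (intro arg_cong[where f = sqrt] integral_cong_AE) auto
  qed
  then show "\<forall>(x, y)\<in>phase_op. (\<forall>z\<in>op_kernel (L2 M) phase_op. hinner (L2 M) x z = 0) \<longrightarrow>
      hnorm (L2 M) y = hnorm (L2 M) x"
    by (fastforce simp: wcomp_op_def)
qed

lemma phase_sqrt_H_comp:
  "AE x in M. complex_of_real (1 / sqrt (H (\<phi> x))) * (complex_of_real (sqrt (H (\<phi> x))) * z x) = z x"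
  using H_pos_comp by eventually_elim simp

text \<open>The phase is defined everywhere, so the product has the domain of multiplication by
  \<open>sqrt (H x)\<close>; on it the two weights cancel after composition with
  \<open>\<phi>\<close>.\<close>

lemma comp_op_eq_phase_op_mult: "comp_op M \<phi> = phase_op \<bullet>\<^sub>o mult_op M (\<lambda>x. sqrt (H x))"
proof (intro equalityI subrelI)
  fix u v assume "(u, v) \<in> comp_op M \<phi>"
  then obtain f where f: "u = L2_class M f" "sq_integrable M f"
    "v = L2_class M (\<lambda>x. f (\<phi> x))" "sq_integrable M (\<lambda>x. f (\<phi> x))"
    by (auto simp: comp_op_def comp_def)
  have s: "sq_integrable M (\<lambda>x. complex_of_real (sqrt (H x)) * f x)"
    using f sq_integrable_comp_iff[of f] by (simp add: sq_integrable_measurable)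
  have "(u, L2_class M (\<lambda>x. complex_of_real (sqrt (H x)) * f x)) \<in> mult_op M (\<lambda>x. sqrt (H x))"
    using s f by (simp add: mult_op_iff)
  moreover have "(L2_class M (\<lambda>x. complex_of_real (sqrt (H x)) * f x), v) \<in> phase_op"
    unfolding phase_op_class[OF s] f(3)
    by (rule L2_class_cong) (use phase_sqrt_H_comp[of "\<lambda>x. f (\<phi> x)"] in eventually_elim, simp)
  ultimately show "(u, v) \<in> phase_op \<bullet>\<^sub>o mult_op M (\<lambda>x. sqrt (H x))"
    by (auto simp: op_mult_def)
next
  fix u v assume "(u, v) \<in> phase_op \<bullet>\<^sub>o mult_op M (\<lambda>x. sqrt (H x))"
  then obtain z where uz: "(u, z) \<in> mult_op M (\<lambda>x. sqrt (H x))" and zv: "(z, v) \<in> phase_op"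
    by (auto simp: op_mult_def)
  from uz obtain f where f: "u = L2_class M f" "sq_integrable M f"
    "z = L2_class M (\<lambda>x. complex_of_real (sqrt (H x)) * f x)" "sq_integrable M (\<lambda>x. complex_of_real (sqrt (H x)) * f x)"
    by (auto simp: wcomp_op_def)
  from zv have "v = L2_class M (\<lambda>x. complex_of_real (1 / sqrt (H (\<phi> x))) * (complex_of_real (sqrt (H (\<phi> x))) * f (\<phi> x)))"
    unfolding f(3) phase_op_class[OF f(4)] .
  also have "\<dots> = L2_class M (\<lambda>x. f (\<phi> x))"
    by (rule L2_class_cong[OF phase_sqrt_H_comp])
  finally show "(u, v) \<in> comp_op M \<phi>"
    using f sq_integrable_comp_iff[of f] by (simp add: sq_integrable_measurable comp_op_iff)
qed

section \<open>Quasinormality and invariance\<close>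

lemma invariant_H: "invariant \<Longrightarrow> AE x in M. H (\<phi> x) = H x"
  by (auto elim!: eventually_mono simp: H_def)

text \<open>The left product is the composition operator. By invariance, \<open>sqrt (H x)\<close>
  times the phase of \<open>f\<close> is a.e. \<open>f (\<phi> x)\<close>, whose square
  integrability also puts the phase of \<open>f\<close> into the domain of the modulus.\<close>

lemma phase_op_commutes:
  assumes invariant
  shows "phase_op \<bullet>\<^sub>o mult_op M (\<lambda>x. sqrt (H x)) \<subseteq> mult_op M (\<lambda>x. sqrt (H x)) \<bullet>\<^sub>o phase_op"
  unfolding comp_op_eq_phase_op_mult[symmetric]
proof (rule subrelI)
  fix u v assume "(u, v) \<in> comp_op M \<phi>"
  then obtain f where f: "u = L2_class M f" "sq_integrable M f"
    "v = L2_class M (\<lambda>x. f (\<phi> x))" "sq_integrable M (\<lambda>x. f (\<phi> x))"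
    by (auto simp: comp_op_def comp_def)
  note [measurable] = f(2)[THEN sq_integrable_measurable]
  let ?g = "\<lambda>x. complex_of_real (1 / sqrt (H (\<phi> x))) * f (\<phi> x)"
  have ae: "AE x in M. complex_of_real (sqrt (H x)) * ?g x = f (\<phi> x)"
    using H_pos_comp invariant_H[OF assms] by eventually_elim simp
  have "sq_integrable M (\<lambda>x. complex_of_real (sqrt (H x)) * ?g x) \<longleftrightarrow> sq_integrable M (\<lambda>x. f (\<phi> x))"
    by (rule sq_integrable_cong_AE[OF _ _ ae]) measurable
  then have "(L2_class M ?g, v) \<in> mult_op M (\<lambda>x. sqrt (H x))"
    using f L2_class_cong[OF ae] mult_op_iff[OF _ sq_integrable_phase[OF f(2)], of "\<lambda>x. sqrt (H x)"] by simp
  moreover have "(u, L2_class M ?g) \<in> phase_op" using f by (simp add: phase_op_class)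
  ultimately show "(u, v) \<in> mult_op M (\<lambda>x. sqrt (H x)) \<bullet>\<^sub>o phase_op"
    by (auto simp: op_mult_def)
qed

text \<open>The inclusion \<open>quasinormal_commutes\<close> is evaluated at one nowhere vanishing
  \<open>f\<close> in the domain of its left side. Comparing values gives
  \<open>H (\<phi> x) * f (\<phi> x) = H x * f (\<phi> x)\<close>, where \<open>f (\<phi> x)\<close>
  cancels.\<close>

lemma quasinormal_imp_invariant:
  assumes "quasinormal (L2 M) (comp_op M \<phi>)"
  shows invariant
proof -
  \<comment> \<open>Exponent 3: the product of \<open>H\<close> and \<open>f\<close> lies in the
    domain of the composition operator if \<open>sqrt (H x) * H x * f x\<close> is square
    integrable, and the square of this is \<open>H x ^ 3 * p x\<close>.\<close>
  obtain p where [measurable]: "p \<in> borel_measurable M" and p: "\<forall>x\<in>space M. 0 < p x"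
    and fin: "(\<integral>\<^sup>+x. ennreal (p x * (1 + H x) ^ 3) \<partial>M) < \<infinity>"
    by (rule ex_positive_weight[of 3])
  have pos: "0 < p x" if "x \<in> space M" for x using p that by blast
  \<comment> \<open>A common majorant of the three functions whose square integrability is
    required.\<close>
  define B where "B x = complex_of_real (sqrt (p x * (1 + H x) ^ 3))" for x
  have [measurable]: "B \<in> borel_measurable M" unfolding B_def by measurable
  have B: "sq_integrable M B"
  proof -
    have "(\<integral>\<^sup>+x. ennreal ((cmod (B x))\<^sup>2) \<partial>M) = (\<integral>\<^sup>+x. ennreal (p x * (1 + H x) ^ 3) \<partial>M)"
    proof (rule nn_integral_cong)
      fix x assume "x \<in> space M"
      then have "0 \<le> p x * (1 + H x) ^ 3" using pos[of x] by simp
      then show "ennreal ((cmod (B x))\<^sup>2) = ennreal (p x * (1 + H x) ^ 3)" by (simp add: B_def)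
    qed
    with fin show ?thesis
      unfolding sq_integrable_def integrable_iff_bounded by simp
  qed
  define f where "f x = complex_of_real (sqrt (p x))" for x
  have [measurable]: "f \<in> borel_measurable M" unfolding f_def by measurable
  have bound: "sq_integrable M (\<lambda>x. complex_of_real (c x) * f x)"
    if [measurable]: "c \<in> borel_measurable M" and c: "\<And>x. \<bar>c x\<bar> \<le> sqrt ((1 + H x) ^ 3)" for c
  proof (rule sq_integrable_bound[OF B])
    show "AE x in M. cmod (complex_of_real (c x) * f x) \<le> cmod (B x)"
      using AE_space
    proof eventually_elim
      case (elim x)
      have "\<bar>c x\<bar> * sqrt (p x) \<le> sqrt ((1 + H x) ^ 3) * sqrt (p x)"
        using c[of x] pos[OF elim] by (intro mult_right_mono) auto
      then show ?case
        using pos[OF elim] by (simp add: B_def f_def norm_mult real_sqrt_mult mult.commute)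
    qed
  qed measurable
  have pow: "(H x) ^ k \<le> (1 + H x) ^ 3" if "k \<le> 3" for x k
    using power_mono[of "H x" "1 + H x" k] power_increasing[OF that, of "1 + H x"] by simp
  have f: "sq_integrable M f"
    using bound[of "\<lambda>_. 1"] pow[of 0] by simp
  have Hf: "sq_integrable M (\<lambda>x. complex_of_real (H x) * f x)"
    by (rule bound) (use pow[of 2] in \<open>auto intro: real_le_rsqrt\<close>)
  have "sq_integrable M (\<lambda>x. complex_of_real (sqrt (H x) * H x) * f x)"
  proof (rule bound)
    fix x
    have "\<bar>sqrt (H x) * H x\<bar> = sqrt (H x ^ 3)"
      by (simp add: power3_eq_cube real_sqrt_mult abs_mult)
    also have "\<dots> \<le> sqrt ((1 + H x) ^ 3)" using pow[of 3] by (intro real_sqrt_le_mono) simp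
    finally show "\<bar>sqrt (H x) * H x\<bar> \<le> sqrt ((1 + H x) ^ 3)" .
  qed measurable
  then have Hf': "sq_integrable M (\<lambda>x. complex_of_real (H (\<phi> x)) * f (\<phi> x))"
    using sq_integrable_comp_iff[of "\<lambda>x. complex_of_real (H x) * f x"] by (simp add: mult.assoc)
  let ?c = "L2_class M (\<lambda>x. complex_of_real (H (\<phi> x)) * f (\<phi> x))"
  have "(L2_class M f, L2_class M (\<lambda>x. complex_of_real (H x) * f x)) \<in> mult_op M H"
    using f Hf by (simp add: mult_op_iff)
  moreover have "(L2_class M (\<lambda>x. complex_of_real (H x) * f x), ?c) \<in> comp_op M \<phi>"
    using Hf Hf' by (simp add: comp_op_iff)
  ultimately have "(L2_class M f, ?c) \<in> comp_op M \<phi> \<bullet>\<^sub>o mult_op M H"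
    by (auto simp: op_mult_def)
  also have "\<dots> \<subseteq> mult_op M H \<bullet>\<^sub>o comp_op M \<phi>"
    using quasinormal_commutes[OF assms] by (simp only: adjoint_mult_comp_op)
  finally obtain z where "(L2_class M f, z) \<in> comp_op M \<phi>" and z: "(z, ?c) \<in> mult_op M H"
    by (auto simp: op_mult_def)
  then have f': "sq_integrable M (\<lambda>x. f (\<phi> x))" "z = L2_class M (\<lambda>x. f (\<phi> x))"
    by (simp_all add: comp_op_iff[OF f])
  from z have "?c = L2_class M (\<lambda>x. complex_of_real (H x) * f (\<phi> x))"
    by (simp add: f' mult_op_iff)
  then have "AE x in M. complex_of_real (H (\<phi> x)) * f (\<phi> x) = complex_of_real (H x) * f (\<phi> x)"
    by (simp add: L2_class_eq_iff[OF Hf'])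
  with AE_space RN_h_eq AE_comp[OF RN_h_eq] show ?thesis
  proof eventually_elim
    case (elim x)
    have "0 < p (\<phi> x)" using elim by (intro pos measurable_space[OF phi_measurable])
    then have "f (\<phi> x) \<noteq> 0" by (simp add: f_def)
    with elim show ?case by simp
  qed
qed

lemma quasinormal_iff_invariant:
  assumes "densely_defined (L2 M) (comp_op M \<phi>)"
  shows "quasinormal (L2 M) (comp_op M \<phi>) \<longleftrightarrow> invariant"
proof
  assume inv: invariant
  have "polar_decomposition (L2 M) (comp_op M \<phi>) phase_op (mult_op M (\<lambda>x. sqrt (H x)))"
    unfolding polar_decomposition_def
    using is_modulus_comp_op[OF assms] partial_isometry_phase_op op_kernel_phase_op comp_op_eq_phase_op_mult
    by blast
  then show "quasinormal (L2 M) (comp_op M \<phi>)"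
    unfolding quasinormal_def
    using assms linear_op_comp_op[OF nonsingular] closed_op_comp_op phase_op_commutes[OF inv] by blast
qed (rule quasinormal_imp_invariant)

end

theorem theorem3p1:
  fixes M :: "'a measure" and \<phi> :: "'a \<Rightarrow> 'a"
  assumes "sigma_finite_measure M"
    and "nonsingular M \<phi>"
    and "densely_defined (L2 M) (comp_op M \<phi>)"
  shows
    "(quasinormal (L2 M) (comp_op M \<phi>) \<longleftrightarrow>
        (\<forall>\<sigma>\<in>sets Borel_Rplus.
           AE x in M. char_fn \<sigma> (RN_h M \<phi> (\<phi> x)) * char_fn \<sigma> (RN_h M \<phi> x) = char_fn \<sigma> (RN_h M \<phi> (\<phi> x)))) \<and>
     (quasinormal (L2 M) (comp_op M \<phi>) \<longleftrightarrow>
        (\<forall>\<sigma>\<in>sets Borel_Rplus.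
           AE x in M. cond_E M \<phi> (\<lambda>y. char_fn \<sigma> (RN_h M \<phi> y)) x = char_fn \<sigma> (RN_h M \<phi> (\<phi> x)))) \<and>
     (quasinormal (L2 M) (comp_op M \<phi>) \<longleftrightarrow>
        (\<forall>f\<in>borel_measurable Borel_Rplus.
           AE x in M. cond_E M \<phi> (\<lambda>y. ext0 f (RN_h M \<phi> y)) x = ext0 f (RN_h M \<phi> (\<phi> x)))) \<and>
     (quasinormal (L2 M) (comp_op M \<phi>) \<longleftrightarrow>
        (\<forall>n::nat. AE x in M. RN_h M (\<phi> ^^ n) x = RN_h M \<phi> x ^ n)) \<and>
     (quasinormal (L2 M) (comp_op M \<phi>) \<longleftrightarrow>
        (AE x in M. cond_E M \<phi> (RN_h M \<phi>) x = RN_h M \<phi> (\<phi> x)) \<and>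
        (\<forall>n::nat. AE x in M. cond_E M \<phi> (RN_h M (\<phi> ^^ n)) x = cond_E M \<phi> (RN_h M \<phi>) x ^ n))"
proof -
  interpret nonsingular_map M \<phi>
    using assms by (simp add: nonsingular_map_def nonsingular_map_axioms_def)
  interpret finite_RN_map M \<phi>
    by unfold_locales (rule densely_defined_imp_RN_h_finite[OF assms(3)])
  note eq = quasinormal_iff_invariant[OF assms(3)]
  show ?thesis
    unfolding eq
    by (intro conjI invariant_iff_char_fn invariant_iff_cond_E_char_fn invariant_iff_cond_E_ext0
        invariant_iff_RN_h_funpow invariant_iff_cond_E_moments)
qed

end
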